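(* Let $n\ge 3$ and let $K$ be a zonoid in $\mathbb{R}^n$ with $\dim K\ge 1$. Then the inequality $$V_1(K)^2\ge \frac{1}{n-1}\sum_{i=1}^nV_1(K|e_i^{\perp})^2$$ holds with equality if and only if either $\dim K=1$, or $\dim K>1$ and $K$ is a zonotope of the form $$K=\sum_{r=1}^{2^n}\left[o,a_r\left(\varepsilon_1^{(r)}u_1,\dots,\varepsilon_n^{(r)}u_n\right)\right],$$ where $u=(u_1,\dots,u_n)\in S^{n-1}$, $a_r\ge 0$ for $r=1,\dots,2^n$, and $\varepsilon_i^{(r)}=\pm 1$ for $i=1,\dots,n$, the sign vectors $(\varepsilon_1^{(r)},\dots,\varepsilon_n^{(r)})$, $r=1,\dots,2^n$, being the $2^n$ elements of $\{-1,1\}^n$.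
   Context: $e_1,\dots,e_n$ is the standard orthonormal basis of $\mathbb{R}^n$, $e_i^\perp$ is the $i$th coordinate hyperplane, $K|e_i^\perp$ is the orthogonal projection of $K$ on $e_i^\perp$, $o$ is the origin, $S^{n-1}$ is the unit sphere, $[x,y]$ is the line segment with endpoints $x,y$, sums of sets are Minkowski sums, and $\dim K$ is the dimension of the affine hull of $K$. $V_1$ is the first intrinsic volume, $V_1(K)=\frac{1}{\kappa_{n-1}}\int_{S^{n-1}}h_K(u)\,du$ for nonempty compact convex $K\subset\mathbb{R}^n$, where $h_K(x)=\sup\{x\cdot y:y\in K\}$ is the support function and $\kappa_{n-1}$ is the volume of the unit ball in $\mathbb{R}^{n-1}$; it is independent of the ambient space (so it equals length for a segment). A zonotope is a finite Minkowski sum of line segments; a zonoid is a limit, in the Hausdorff metric, of zonotopes.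
   Formalization: In the equality case with dim K>1, K is only required to be a translate t + Σ[o, a_r(ε^(r)u)] of the displayed zonotope, since the inequality is translation invariant while every displayed zonotope contains o, so the literal "only if" fails. *)

theory Defs
  imports "HOL-Analysis.Analysis"
begin

text \<open>
  Sums of sets, binary and indexed, are the Minkowski sums of \<^theory>\<open>HOL-Library.Set_Algebras\<close>.
\<close>

definition support_fun :: "'a::euclidean_space set \<Rightarrow> 'a \<Rightarrow> real" where
  "support_fun K x = (SUP y\<in>K. x \<bullet> y)"

text \<open>
  Spherical Lebesgue measure: the measure of a Borel subset \<open>A\<close> of the unit sphere is \<open>n\<close> times
  the volume of the cone \<open>{t *\<^sub>R x | x \<in> A, 0 < t < 1}\<close>, where \<open>n\<close> is the dimension
  (see \<open>emeasure_sphere_measure\<close> below). Total mass: \<open>n * unit_ball_vol n\<close>.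
\<close>

definition sphere_measure :: "'a::euclidean_space measure" where
  "sphere_measure =
     scale_measure (of_nat DIM('a))
       (distr (restrict_space lborel (ball 0 1 - {0})) (restrict_space borel (sphere 0 1))
          (\<lambda>x. x /\<^sub>R norm x))"

lemma emeasure_sphere_measure:
  fixes A :: "'a::euclidean_space set"
  assumes "A \<in> sets borel" "A \<subseteq> sphere 0 1"
  shows "emeasure sphere_measure A
         = of_nat DIM('a) * emeasure lborel {t *\<^sub>R x | t x. x \<in> A \<and> 0 < t \<and> t < 1}"
proof -
  let ?M = "restrict_space lborel (ball 0 1 - {0}) :: 'a measure"
  have meas: "(\<lambda>x::'a. x /\<^sub>R norm x) \<in> measurable ?M (restrict_space borel (sphere 0 1))"
    by (rule measurable_restrict_space2)
       (auto simp: space_restrict_space intro!: measurable_restrict_space1)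
  have A: "A \<in> sets (restrict_space borel (sphere 0 1))"
    using assms by (simp add: sets_restrict_space_iff)
  have eq: "(\<lambda>x. x /\<^sub>R norm x) -` A \<inter> space ?M = {t *\<^sub>R x | t x. x \<in> A \<and> 0 < t \<and> t < 1}"
  proof (intro equalityI subsetI)
    fix x assume x: "x \<in> (\<lambda>x. x /\<^sub>R norm x) -` A \<inter> space ?M"
    then have "x = norm x *\<^sub>R (x /\<^sub>R norm x)" "0 < norm x" "norm x < 1"
      by (auto simp: space_restrict_space)
    then show "x \<in> {t *\<^sub>R x | t x. x \<in> A \<and> 0 < t \<and> t < 1}"
      using x by blast
  next
    fix y assume "y \<in> {t *\<^sub>R x | t x. x \<in> A \<and> 0 < t \<and> t < 1}"
    then obtain t x where "y = t *\<^sub>R x" "x \<in> A" "0 < t" "t < 1" by blast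
    moreover from \<open>x \<in> A\<close> have "norm x = 1" using assms(2) by auto
    ultimately show "y \<in> (\<lambda>x. x /\<^sub>R norm x) -` A \<inter> space ?M"
      by (auto simp: space_restrict_space)
  qed
  have "emeasure sphere_measure A = of_nat DIM('a) * emeasure ?M ((\<lambda>x. x /\<^sub>R norm x) -` A \<inter> space ?M)"
    unfolding sphere_measure_def by (simp add: emeasure_distr[OF meas A])
  also have "emeasure ?M ((\<lambda>x. x /\<^sub>R norm x) -` A \<inter> space ?M)
      = emeasure lborel ((\<lambda>x. x /\<^sub>R norm x) -` A \<inter> space ?M)"
    by (rule emeasure_restrict_space) (auto simp: space_restrict_space)
  finally show ?thesis unfolding eq .
qed

definition first_intrinsic_volume :: "'a::euclidean_space set \<Rightarrow> real" where
  "first_intrinsic_volume K =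
     (LINT u|sphere_measure. support_fun K u) / unit_ball_vol (real (DIM('a) - 1))"

definition hausdorff_dist :: "'a::metric_space set \<Rightarrow> 'a set \<Rightarrow> real" where
  "hausdorff_dist K L = max (SUP x\<in>K. infdist x L) (SUP y\<in>L. infdist y K)"

definition zonotope :: "'a::euclidean_space set \<Rightarrow> bool" where
  "zonotope Z \<longleftrightarrow>
     (\<exists>(m::nat) (a::nat \<Rightarrow> 'a) b. Z = (\<Sum>i<m. closed_segment (a i) (b i)))"

text \<open>
  The limit is taken among nonempty compact sets, where \<^const>\<open>hausdorff_dist\<close> is a metric;
  convexity of the limit is automatic.
\<close>

definition zonoid :: "'a::euclidean_space set \<Rightarrow> bool" where
  "zonoid K \<longleftrightarrow> compact K \<and> K \<noteq> {} \<and>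
     (\<exists>Z. (\<forall>k. zonotope (Z k)) \<and> (\<lambda>k. hausdorff_dist (Z k) K) \<longlonglongrightarrow> 0)"

definition coord_proj :: "'n::finite \<Rightarrow> (real ^ 'n) set \<Rightarrow> (real ^ 'n) set" where
  "coord_proj i K = (\<lambda>x. x - (x \<bullet> axis i 1) *\<^sub>R axis i 1) ` K"

definition sign_vectors :: "(real ^ 'n::finite) set" where
  "sign_vectors = {\<epsilon>. \<forall>i. \<epsilon> $ i = 1 \<or> \<epsilon> $ i = - 1}"

text \<open>
  All segments start at the origin, while \<^const>\<open>first_intrinsic_volume\<close> is translation
  invariant; a general zonoid can therefore only be compared with these sets up to translation.
\<close>

definition sign_zonotope :: "real ^ 'n \<Rightarrow> (real ^ 'n \<Rightarrow> real) \<Rightarrow> (real ^ 'n::finite) set" where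
  "sign_zonotope u a = (\<Sum>\<epsilon>\<in>sign_vectors. closed_segment 0 (a \<epsilon> *\<^sub>R (\<chi> i. \<epsilon> $ i * u $ i)))"

end

theory Submission
  imports Defs
begin

text \<open>
  On segments the first intrinsic volume is a fixed positive multiple \<open>c\<close> of the length, by
  rotation invariance; the value of \<open>c\<close> is irrelevant. For a zonotope with edge vectors \<open>v\<^sub>j\<close> the
  inequality is therefore the triangle inequality for the vectors \<open>f(v\<^sub>j)\<close>, where \<open>f(v)\<close> lists the
  lengths of the coordinate shadows of \<open>v\<close> and \<open>\<bar>f(v)\<bar>\<^sup>2 = (n - 1) \<bar>v\<bar>\<^sup>2\<close>; zonoids follow by
  continuity. In the equality case the total defect in the triangle inequality tends to \<open>0\<close> along
  an approximating sequence of zonotopes. Hence, up to a total error tending to \<open>0\<close>, all edge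
  vectors are of the form \<open>r (\<epsilon>\<^sub>1 u\<^sub>1, \<dots>, \<epsilon>\<^sub>n u\<^sub>n)\<close> with the same \<open>u\<close>, determined by the ratios
  \<open>V\<^sub>1(K|e\<^sub>i\<^sup>\<bottom>) / V\<^sub>1(K)\<close>. Grouping them by sign pattern leaves boundedly many bounded parameters,
  and a convergent subsequence of these gives the representation of \<open>K\<close>.
\<close>

section \<open>Rotation invariance of spherical measure\<close>

lemma orthogonal_transformation_borel_measurable:
  fixes g :: "'a::euclidean_space \<Rightarrow> 'a"
  assumes "orthogonal_transformation g"
  shows "g \<in> borel \<rightarrow>\<^sub>M borel"
  using assms orthogonal_transformation_linear linear_continuous_on linear_conv_bounded_linear
    borel_measurable_continuous_onI by blast

lemma nn_integral_lborel_translate: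
  fixes f :: "'a::euclidean_space \<Rightarrow> ennreal"
  assumes [measurable]: "f \<in> borel_measurable borel"
  shows "(\<integral>\<^sup>+x. f (c + x) \<partial>lborel) = (\<integral>\<^sup>+x. f x \<partial>lborel)"
proof -
  have "(\<integral>\<^sup>+x. f x \<partial>lborel) = (\<integral>\<^sup>+x. f x \<partial>distr lborel borel ((+) c))"
    by (simp add: lborel_distr_plus)
  also have "\<dots> = (\<integral>\<^sup>+x. f (c + x) \<partial>lborel)"
    by (subst nn_integral_distr) auto
  finally show ?thesis ..
qed

lemma nn_integral_lborel_reflect:
  fixes f :: "'a::euclidean_space \<Rightarrow> ennreal"
  assumes [measurable]: "f \<in> borel_measurable borel"
  shows "(\<integral>\<^sup>+x. f (c - x) \<partial>lborel) = (\<integral>\<^sup>+x. f x \<partial>lborel)"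
proof -
  have "(\<integral>\<^sup>+x. f x \<partial>lborel) = (\<integral>\<^sup>+x. f x \<partial>distr lborel borel (\<lambda>x. c + (-1) *\<^sub>R x))"
    by (subst lborel_affine[of "-1" c]) (simp_all add: density_1)
  also have "\<dots> = (\<integral>\<^sup>+x. f (c - x) \<partial>lborel)"
    by (subst nn_integral_distr) auto
  finally show ?thesis ..
qed

text \<open>
  The image measure is again translation invariant, and evaluating
  \<open>\<integral>\<integral> 1\<^sub>A(g x) 1\<^sub>B(y + g x) dx dy\<close> in both orders shows that it is proportional to Lebesgue
  measure; taking the unit ball for \<open>B\<close> identifies the constant as \<open>1\<close>.
\<close>

lemma lborel_distr_orthogonal:
  fixes g :: "'a::euclidean_space \<Rightarrow> 'a"
  assumes g: "orthogonal_transformation g"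
  shows "distr lborel borel g = lborel"
proof (rule measure_eqI)
  fix A :: "'a set" assume "A \<in> sets (distr lborel borel g)"
  then have A [measurable]: "A \<in> sets borel" by simp
  note [measurable] = orthogonal_transformation_borel_measurable[OF g]
  define B :: "'a set" where "B = ball 0 1"
  have B [measurable]: "B \<in> sets borel" by (simp add: B_def)
  have gB: "g x \<in> B \<longleftrightarrow> x \<in> B" for x
    using g by (simp add: B_def orthogonal_transformation_norm)
  have shift: "(\<integral>\<^sup>+x. indicator A (g x) * indicator B (y + g x) \<partial>lborel)
      = (\<integral>\<^sup>+x. indicator A (g x - y) * indicator B (g x) \<partial>(lborel :: 'a measure))" for y
  proof -
    \<comment> \<open>As \<open>g\<close> is onto, the shift by \<open>y\<close> outside
      \<open>g\<close> becomes a shift by \<open>z\<close> of the integration variable.\<close>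
    obtain z where z: "y = g z"
      using orthogonal_transformation_surj[OF g] by (metis surjD)
    have "(\<integral>\<^sup>+x. indicator A (g x - y) * indicator B (g x) \<partial>(lborel :: 'a measure))
        = (\<integral>\<^sup>+x. indicator A (g (z + x) - y) * indicator B (g (z + x)) \<partial>(lborel :: 'a measure))"
      by (rule nn_integral_lborel_translate[symmetric]) measurable
    also have "\<dots> = (\<integral>\<^sup>+x. indicator A (g x) * indicator B (y + g x) \<partial>lborel)"
      using orthogonal_transformation_linear[OF g] by (simp add: z linear_add)
    finally show ?thesis ..
  qed
  have ind: "(\<integral>\<^sup>+x. indicator C (g x) \<partial>lborel) = emeasure (distr lborel borel g) C"
    if [measurable]: "C \<in> sets borel" for C
  proof -
    have "emeasure (distr lborel borel g) C = (\<integral>\<^sup>+x. indicator C x \<partial>distr lborel borel g)"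
      by simp
    also have "\<dots> = (\<integral>\<^sup>+x. indicator C (g x) \<partial>lborel)"
      by (subst nn_integral_distr) auto
    finally show ?thesis ..
  qed
  have "emeasure (distr lborel borel g) A * emeasure lborel B
      = (\<integral>\<^sup>+x. indicator A (g x) * emeasure lborel B \<partial>lborel)"
    by (subst nn_integral_multc) (auto simp: ind)
  also have "\<dots> = (\<integral>\<^sup>+x. (\<integral>\<^sup>+y. indicator A (g x) * indicator B (y + g x) \<partial>lborel) \<partial>lborel)"
  proof (rule nn_integral_cong)
    fix x
    have "(\<integral>\<^sup>+y. indicator B (y + g x) \<partial>lborel) = emeasure lborel B"
      using nn_integral_lborel_translate[of "indicator B" "g x"] by (simp add: add.commute)
    then show "indicator A (g x) * emeasure lborel B
        = (\<integral>\<^sup>+y. indicator A (g x) * indicator B (y + g x) \<partial>lborel)"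
      by (subst nn_integral_cmult) auto
  qed
  also have "\<dots> = (\<integral>\<^sup>+y. (\<integral>\<^sup>+x. indicator A (g x) * indicator B (y + g x) \<partial>lborel) \<partial>lborel)"
    by (rule lborel_pair.Fubini') measurable
  also have "\<dots> = (\<integral>\<^sup>+y. (\<integral>\<^sup>+x. indicator A (g x - y) * indicator B (g x) \<partial>lborel) \<partial>lborel)"
    by (simp only: shift)
  also have "\<dots> = (\<integral>\<^sup>+x. (\<integral>\<^sup>+y. indicator A (g x - y) * indicator B (g x) \<partial>lborel) \<partial>lborel)"
    by (rule lborel_pair.Fubini') measurable
  also have "\<dots> = (\<integral>\<^sup>+x. emeasure lborel A * indicator B x \<partial>lborel)"
  proof (rule nn_integral_cong)
    fix x
    have "(\<integral>\<^sup>+y. indicator A (g x - y) \<partial>lborel) = emeasure lborel A"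
      using nn_integral_lborel_reflect[of "indicator A" "g x"] by simp
    then show "(\<integral>\<^sup>+y. indicator A (g x - y) * indicator B (g x) \<partial>lborel)
        = emeasure lborel A * indicator B x"
      by (subst nn_integral_multc) (auto simp: gB indicator_def)
  qed
  also have "\<dots> = emeasure lborel A * emeasure lborel B"
    by (subst nn_integral_cmult) auto
  finally have eq: "emeasure (distr lborel borel g) A * emeasure lborel B
      = emeasure lborel A * emeasure lborel B" .
  have "emeasure lborel B = ennreal (unit_ball_vol (real DIM('a)))"
    using emeasure_ball[of 1 "0::'a"] by (simp add: B_def)
  then have "emeasure lborel B \<noteq> 0" "emeasure lborel B \<noteq> \<infinity>"
    using unit_ball_vol_pos[of "real DIM('a)"] by (auto simp: less_le)
  with eq show "emeasure (distr lborel borel g) A = emeasure lborel A"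
    by (simp add: mult.commute[of _ "emeasure lborel B"] ennreal_mult_cancel_left)
qed auto

section \<open>Integration over the unit sphere\<close>

lemma space_sphere_measure: "space (sphere_measure :: 'a::euclidean_space measure) = sphere 0 1"
  by (simp add: sphere_measure_def space_scale_measure space_restrict_space)

lemma sets_sphere_measure [measurable_cong]:
  "sets (sphere_measure :: 'a::euclidean_space measure) = sets (restrict_space borel (sphere 0 1))"
  by (simp add: sphere_measure_def)

lemma borel_measurable_sphere_measure:
  assumes "f \<in> borel_measurable borel"
  shows "f \<in> borel_measurable sphere_measure"
  using measurable_restrict_space1[OF assms] measurable_cong_sets[OF sets_sphere_measure refl] by blast

text \<open>The integrand is extended to the punctured ball, constant along rays, so that facts
  about \<open>lborel\<close> carry over to the sphere.\<close>

lemma nn_integral_sphere_measure: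
  fixes f :: "'a::euclidean_space \<Rightarrow> ennreal"
  assumes f: "f \<in> borel_measurable borel"
  shows "(\<integral>\<^sup>+u. f u \<partial>sphere_measure)
    = of_nat DIM('a) * (\<integral>\<^sup>+x. f (x /\<^sub>R norm x) * indicator (ball 0 1 - {0}) x \<partial>lborel)"
proof -
  let ?M = "restrict_space lborel (ball 0 1 - {0}) :: 'a measure"
  have meas: "(\<lambda>x::'a. x /\<^sub>R norm x) \<in> measurable ?M (restrict_space borel (sphere 0 1))"
    by (rule measurable_restrict_space2)
       (auto simp: space_restrict_space intro!: measurable_restrict_space1)
  have f': "f \<in> borel_measurable (restrict_space borel (sphere 0 1))"
    using f by (rule measurable_restrict_space1)
  show ?thesis
    unfolding sphere_measure_def
    by (subst nn_integral_scale_measure, use f' in simp,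
        subst nn_integral_distr[OF meas], use f' in simp,
        subst nn_integral_restrict_space) auto
qed

text \<open>Since \<open>g\<close> is linear and preserves norms, composing with \<open>g\<close>
  before or after the ray-constant extension gives the same function; the invariance of
  \<open>lborel\<close> does the rest.\<close>

lemma nn_integral_sphere_orthogonal:
  fixes f :: "'a::euclidean_space \<Rightarrow> ennreal" and g :: "'a \<Rightarrow> 'a"
  assumes [measurable]: "f \<in> borel_measurable borel" and g: "orthogonal_transformation g"
  shows "(\<integral>\<^sup>+u. f (g u) \<partial>sphere_measure) = (\<integral>\<^sup>+u. f u \<partial>sphere_measure)"
proof -
  note [measurable] = orthogonal_transformation_borel_measurable[OF g]
  have [measurable]: "ball 0 1 - {0::'a} \<in> sets borel" by simp
  define F where "F x = f (x /\<^sub>R norm x) * indicator (ball 0 1 - {0}) x" for x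
  have [measurable]: "F \<in> borel_measurable borel" unfolding F_def by measurable
  have F: "F (g x) = f (g (x /\<^sub>R norm x)) * indicator (ball 0 1 - {0}) x" for x
  proof -
    have "g x = 0 \<longleftrightarrow> x = 0" using g
      by (metis norm_eq_zero orthogonal_transformation_norm)
    then show ?thesis
    using g by (auto simp: F_def orthogonal_transformation_norm indicator_def
        orthogonal_transformation_linear linear_cmul)
  qed
  have "(\<integral>\<^sup>+x. F x \<partial>lborel) = (\<integral>\<^sup>+x. F x \<partial>distr lborel borel g)"
    by (simp add: lborel_distr_orthogonal[OF g])
  also have "\<dots> = (\<integral>\<^sup>+x. F (g x) \<partial>lborel)" by (subst nn_integral_distr) auto
  finally show ?thesis
    by (subst (1 2) nn_integral_sphere_measure) (simp_all add: F[symmetric] F_def[symmetric])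
qed

lemma emeasure_sphere_measure_space:
  "emeasure (sphere_measure :: 'a::euclidean_space measure) (sphere 0 1)
    = ennreal (real DIM('a) * unit_ball_vol (real DIM('a)))"
proof -
  have "emeasure (sphere_measure :: 'a measure) (sphere 0 1) = (\<integral>\<^sup>+u. 1 \<partial>(sphere_measure :: 'a measure))"
    by (simp add: space_sphere_measure)
  also have "\<dots> = of_nat DIM('a) * emeasure lborel (ball 0 1 - {0} :: 'a set)"
    by (subst nn_integral_sphere_measure) auto
  also have "emeasure lborel (ball 0 1 - {0} :: 'a set) = emeasure lborel (ball 0 1 :: 'a set)"
    by (rule emeasure_Diff_null_set) (auto simp: null_sets_def)
  finally show ?thesis
    by (simp add: emeasure_ball ennreal_mult ennreal_of_nat_eq_real_of_nat)
qed

lemma finite_measure_sphere_measure: "finite_measure (sphere_measure :: 'a::euclidean_space measure)"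
  by (rule finite_measureI) (simp add: space_sphere_measure emeasure_sphere_measure_space)

lemma measure_sphere_measure_pos:
  "0 < measure (sphere_measure :: 'a::euclidean_space measure) (sphere 0 1)"
  by (simp add: measure_def emeasure_sphere_measure_space)

lemma integrable_sphere_measure:
  fixes f :: "'a::euclidean_space \<Rightarrow> real"
  assumes "continuous_on UNIV f"
  shows "integrable sphere_measure f"
proof -
  interpret finite_measure "sphere_measure :: 'a measure" by (rule finite_measure_sphere_measure)
  have "bounded (f ` sphere 0 1)"
    using assms by (intro compact_imp_bounded compact_continuous_image)
      (auto intro: continuous_on_subset)
  then obtain B where "\<forall>x\<in>sphere 0 1. norm (f x) \<le> B" by (auto simp: bounded_iff)
  then show ?thesis
    by (intro integrable_const_bound[of _ B] AE_I2 borel_measurable_sphere_measure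
        borel_measurable_continuous_onI assms) (auto simp: space_sphere_measure)
qed

text \<open>The positive part of \<open>v \<bullet> u\<close> is the support function of the segment
  from the origin to \<open>v\<close>, so this is the first intrinsic volume of that segment before
  normalisation.\<close>

definition half_width_integral :: "'a::euclidean_space \<Rightarrow> real" where
  "half_width_integral v = (LINT u|sphere_measure. max 0 (v \<bullet> u))"

lemma continuous_on_max_inner: "continuous_on UNIV (\<lambda>u::'a::euclidean_space. max 0 (v \<bullet> u))"
  by (intro continuous_intros)

text \<open>Invariance under orthogonal maps is established for nonnegative integrals, hence the
  passage from the Bochner integral.\<close>

lemma half_width_integral_eq_nn:
  "half_width_integral v = enn2real (\<integral>\<^sup>+u. ennreal (max 0 (v \<bullet> u)) \<partial>sphere_measure)"
  unfolding half_width_integral_def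
  by (rule integral_eq_nn_integral)
    (auto intro!: borel_measurable_sphere_measure borel_measurable_continuous_onI continuous_on_max_inner)

lemma half_width_integral_orthogonal:
  fixes v :: "'a::euclidean_space" and g :: "'a \<Rightarrow> 'a"
  assumes g: "orthogonal_transformation g"
  shows "half_width_integral (g v) = half_width_integral v"
proof -
  have "(\<integral>\<^sup>+u. ennreal (max 0 (g v \<bullet> u)) \<partial>sphere_measure)
      = (\<integral>\<^sup>+u. ennreal (max 0 (g v \<bullet> g u)) \<partial>sphere_measure)"
    by (rule nn_integral_sphere_orthogonal[OF _ g, symmetric]) measurable
  then show ?thesis
    using g by (simp add: half_width_integral_eq_nn orthogonal_transformation_def)
qed

lemma half_width_integral_scaleR:
  assumes "0 \<le> r"
  shows "half_width_integral (r *\<^sub>R v) = r * half_width_integral v"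
proof -
  have "max 0 ((r *\<^sub>R v) \<bullet> u) = r * max 0 (v \<bullet> u)" for u
    using assms by (simp add: max_mult_distrib_left)
  then show ?thesis by (simp add: half_width_integral_def)
qed

text \<open>Some orthogonal map carries \<open>v\<close> to \<open>norm v *\<^sub>R e\<close>;
  positive homogeneity then extracts the length.\<close>

lemma half_width_integral_eq:
  fixes v e :: "real ^ 'n"
  assumes "norm e = 1"
  shows "half_width_integral v = norm v * half_width_integral e"
proof -
  have "norm v = norm (norm v *\<^sub>R e)" using assms by simp
  then obtain g where "orthogonal_transformation g" "g v = norm v *\<^sub>R e"
    by (rule orthogonal_transformation_exists)
  then have "half_width_integral v = half_width_integral (norm v *\<^sub>R e)"
    by (metis half_width_integral_orthogonal)
  then show ?thesis by (simp add: half_width_integral_scaleR)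
qed

text \<open>A linear functional is the difference of the positive parts belonging to
  \<open>a\<close> and \<open>- a\<close>, whose integrals agree because negation is orthogonal.
  This is why the position of a segment does not affect its first intrinsic volume.\<close>

lemma LINT_sphere_inner_eq_0:
  fixes a :: "'a::euclidean_space"
  shows "(LINT u|sphere_measure. a \<bullet> u) = 0"
proof -
  have "(LINT u|sphere_measure. a \<bullet> u)
      = (LINT u|sphere_measure. max 0 (a \<bullet> u) - max 0 ((- a) \<bullet> u))"
    by (rule Bochner_Integration.integral_cong) auto
  also have "\<dots> = half_width_integral a - half_width_integral (- a)"
    unfolding half_width_integral_def
    by (rule Bochner_Integration.integral_diff; rule integrable_sphere_measure[OF continuous_on_max_inner])
  also have "half_width_integral (- a) = half_width_integral a"
    by (rule half_width_integral_orthogonal) (simp add: orthogonal_transformation_neg orthogonal_transformation_id)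
  finally show ?thesis by simp
qed

text \<open>On the unit sphere the absolute coordinates sum to at least 1. Split into positive
  parts, this sum integrates to a positive multiple of the value at \<open>e\<close>, by rotation
  invariance, and to at least the total mass of the sphere.\<close>

lemma half_width_integral_pos:
  fixes e :: "real ^ 'n"
  assumes e: "norm e = 1"
  shows "0 < half_width_integral e"
proof -
  interpret finite_measure "sphere_measure :: (real^'n) measure" by (rule finite_measure_sphere_measure)
  let ?f = "\<lambda>u::real^'n. \<Sum>i\<in>UNIV. max 0 (axis i 1 \<bullet> u) + max 0 ((- axis i 1) \<bullet> u)"
  have "measure (sphere_measure :: (real^'n) measure) (sphere 0 1) = (LINT u|(sphere_measure :: (real^'n) measure). 1)"
    by (simp add: space_sphere_measure)
  also have "\<dots> \<le> (LINT u|sphere_measure. ?f u)"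
  proof (rule integral_mono)
    show "integrable sphere_measure ?f"
      by (rule integrable_sphere_measure) (intro continuous_intros)
    fix u :: "real^'n" assume "u \<in> space sphere_measure"
    then have "1 = norm u" by (simp add: space_sphere_measure)
    also have "\<dots> \<le> (\<Sum>i\<in>UNIV. \<bar>u $ i\<bar>)" by (rule norm_le_l1_cart)
    also have "\<dots> = ?f u" by (rule sum.cong) (auto simp: inner_axis' max_def)
    finally show "1 \<le> ?f u" .
  qed simp
  also have "\<dots> = (\<Sum>i\<in>UNIV. half_width_integral (axis i 1 :: real^'n) + half_width_integral (- axis i 1 :: real^'n))"
    unfolding half_width_integral_def
    by (subst Bochner_Integration.integral_sum)
      (auto intro!: integrable_sphere_measure continuous_intros sum.cong Bochner_Integration.integral_add)
  also have "\<dots> = 2 * real CARD('n) * half_width_integral e"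
    by (subst (1 2) half_width_integral_eq[OF e]) (simp add: norm_axis_1)
  finally have "0 < 2 * real CARD('n) * half_width_integral e"
    using measure_sphere_measure_pos[where 'a = "real^'n"] by linarith
  then show ?thesis by (simp add: zero_less_mult_iff)
qed

section \<open>Support functions and Hausdorff distance\<close>

lemma bdd_above_inner_image:
  fixes K :: "'a::euclidean_space set"
  assumes "compact K"
  shows "bdd_above ((\<bullet>) x ` K)"
  using assms
  by (intro bounded_imp_bdd_above compact_imp_bounded compact_continuous_image continuous_intros)

lemma support_fun_upper:
  assumes "compact K" "y \<in> K"
  shows "x \<bullet> y \<le> support_fun K x"
  unfolding support_fun_def by (rule cSUP_upper[OF assms(2) bdd_above_inner_image[OF assms(1)]])

lemma support_fun_least:
  assumes "K \<noteq> {}" "\<And>y. y \<in> K \<Longrightarrow> x \<bullet> y \<le> c"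
  shows "support_fun K x \<le> c"
  unfolding support_fun_def using assms by (rule cSUP_least)

lemma support_fun_attained:
  assumes "compact K" "K \<noteq> {}"
  obtains y where "y \<in> K" "support_fun K x = x \<bullet> y"
proof -
  have "continuous_on K ((\<bullet>) x)" by (intro continuous_intros)
  then obtain y where y: "y \<in> K" "\<forall>z\<in>K. x \<bullet> z \<le> x \<bullet> y"
    using continuous_attains_sup[OF assms] by blast
  moreover have "support_fun K x = x \<bullet> y"
    using y assms by (intro antisym support_fun_least support_fun_upper) auto
  ultimately show thesis using that by blast
qed

lemma compact_set_plus:
  fixes A B :: "'a::real_normed_vector set"
  assumes "compact A" "compact B"
  shows "compact (A + B)"
proof -
  have "A + B = {x + y | x y. x \<in> A \<and> y \<in> B}"
    by (auto simp: set_plus_def)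
  then show ?thesis using compact_sums[OF assms] by simp
qed

lemma set_plus_nonempty: "A \<noteq> {} \<Longrightarrow> B \<noteq> {} \<Longrightarrow> A + B \<noteq> {}"
  by (auto simp: set_plus_def)

lemma support_fun_plus:
  assumes "compact A" "A \<noteq> {}" "compact B" "B \<noteq> {}"
  shows "support_fun (A + B) x = support_fun A x + support_fun B x"
proof (rule antisym)
  show "support_fun (A + B) x \<le> support_fun A x + support_fun B x"
  proof (rule support_fun_least)
    fix y assume "y \<in> A + B"
    then obtain a b where "a \<in> A" "b \<in> B" "y = a + b" by (auto simp: set_plus_def)
    then show "x \<bullet> y \<le> support_fun A x + support_fun B x"
      using assms by (simp add: inner_add_right add_mono support_fun_upper)
  qed (use assms set_plus_nonempty in blast)
next
  obtain a where "a \<in> A" "support_fun A x = x \<bullet> a" using support_fun_attained assms by blast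
  moreover obtain b where "b \<in> B" "support_fun B x = x \<bullet> b" using support_fun_attained assms by blast
  ultimately show "support_fun A x + support_fun B x \<le> support_fun (A + B) x"
    using support_fun_upper[of "A + B" "a + b" x] assms
    by (auto simp: inner_add_right compact_set_plus)
qed

text \<open>A linear functional on a segment is largest at an endpoint. The formula separates the
  base point, whose contribution integrates to 0, from the edge vector.\<close>

lemma support_fun_closed_segment:
  "support_fun (closed_segment a b) x = a \<bullet> x + max 0 ((b - a) \<bullet> x)"
proof (rule antisym)
  show "support_fun (closed_segment a b) x \<le> a \<bullet> x + max 0 ((b - a) \<bullet> x)"
  proof (rule support_fun_least)
    fix y assume "y \<in> closed_segment a b"
    then obtain t where t: "0 \<le> t" "t \<le> 1" "y = a + t *\<^sub>R (b - a)"
      by (auto simp: in_segment algebra_simps)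
    have "t * ((b - a) \<bullet> x) \<le> max 0 ((b - a) \<bullet> x)"
      using t by (cases "(b - a) \<bullet> x \<ge> 0")
        (auto simp: mult_left_le_one_le mult_nonneg_nonpos not_le max_def)
    then show "x \<bullet> y \<le> a \<bullet> x + max 0 ((b - a) \<bullet> x)"
      using t by (simp add: inner_add_left inner_commute[of x])
  qed simp
  have "x \<bullet> a \<le> support_fun (closed_segment a b) x" "x \<bullet> b \<le> support_fun (closed_segment a b) x"
    by (auto intro: support_fun_upper)
  then show "a \<bullet> x + max 0 ((b - a) \<bullet> x) \<le> support_fun (closed_segment a b) x"
    by (simp add: inner_diff_left inner_commute[of x] max_def)
qed

text \<open>For infinite \<open>J\<close> the sum is \<open>{0}\<close> by convention, so the case
  \<open>P {0}\<close> covers it.\<close>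

lemma sum_of_sets_induct:
  fixes S :: "'i \<Rightarrow> 'a::comm_monoid_add set"
  assumes "P {0}" "\<And>A B. P A \<Longrightarrow> P B \<Longrightarrow> P (A + B)" "\<And>j. j \<in> J \<Longrightarrow> P (S j)"
  shows "P (\<Sum>j\<in>J. S j)"
  using assms(3)
  by (induction J rule: infinite_finite_induct) (auto simp: assms(1,2) set_zero)

lemma compact_set_sum:
  fixes S :: "'i \<Rightarrow> 'a::real_normed_vector set"
  assumes "\<And>j. j \<in> J \<Longrightarrow> compact (S j)"
  shows "compact (\<Sum>j\<in>J. S j)"
  by (rule sum_of_sets_induct) (use assms compact_set_plus in auto)

lemma set_sum_nonempty:
  fixes S :: "'i \<Rightarrow> 'a::comm_monoid_add set"
  assumes "\<And>j. j \<in> J \<Longrightarrow> S j \<noteq> {}"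
  shows "(\<Sum>j\<in>J. S j) \<noteq> {}"
  by (rule sum_of_sets_induct) (use assms set_plus_nonempty in auto)

lemma sum_mem_set_sum:
  fixes S :: "'i \<Rightarrow> 'a::comm_monoid_add set"
  assumes "\<And>j. j \<in> J \<Longrightarrow> a j \<in> S j"
  shows "(\<Sum>j\<in>J. a j) \<in> (\<Sum>j\<in>J. S j)"
  using assms by (induction J rule: infinite_finite_induct) (auto simp: set_zero)

lemma support_fun_sum:
  fixes S :: "'i \<Rightarrow> 'a::euclidean_space set"
  assumes "finite J" "\<And>j. j \<in> J \<Longrightarrow> compact (S j) \<and> S j \<noteq> {}"
  shows "support_fun (\<Sum>j\<in>J. S j) x = (\<Sum>j\<in>J. support_fun (S j) x)"
  using assms
proof (induction J rule: finite_induct)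
  case empty
  then show ?case by (simp add: support_fun_def set_zero)
next
  case (insert j J)
  then show ?case by (simp add: support_fun_plus compact_set_sum set_sum_nonempty)
qed

text \<open>By Cauchy-Schwarz, any bound on the norms of the points of \<open>K\<close> is a
  Lipschitz constant.\<close>

lemma continuous_on_support_fun:
  assumes "compact K" "K \<noteq> {}"
  shows "continuous_on UNIV (support_fun K)"
proof -
  obtain B where B: "\<And>y. y \<in> K \<Longrightarrow> norm y \<le> B"
    using compact_imp_bounded[OF assms(1)] by (auto simp: bounded_iff)
  have le: "support_fun K x - support_fun K z \<le> B * norm (x - z)" for x z
  proof -
    have "support_fun K x \<le> support_fun K z + B * norm (x - z)"
    proof (rule support_fun_least[OF assms(2)])
      fix y assume y: "y \<in> K"
      have "x \<bullet> y = z \<bullet> y + (x - z) \<bullet> y" by (simp add: inner_diff_left)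
      also have "(x - z) \<bullet> y \<le> norm (x - z) * norm y" by (rule norm_cauchy_schwarz)
      also have "\<dots> \<le> norm (x - z) * B" using B[OF y] by (rule mult_left_mono) simp
      finally show "x \<bullet> y \<le> support_fun K z + B * norm (x - z)"
        using support_fun_upper[OF assms(1) y, of z] by (simp add: mult.commute)
    qed
    then show ?thesis by simp
  qed
  have "0 \<le> B" using B assms(2) norm_ge_zero order_trans by blast
  have "B-lipschitz_on UNIV (support_fun K)"
  proof (rule lipschitz_onI)
    fix x z
    show "dist (support_fun K x) (support_fun K z) \<le> B * dist x z"
      using le[of x z] le[of z x] by (simp add: dist_norm abs_le_iff norm_minus_commute)
  qed fact
  then show ?thesis by (rule lipschitz_on_continuous_on)
qed

section \<open>Additivity, continuity and monotonicity of the first intrinsic volume\<close>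

lemma integrable_support_fun:
  "compact K \<Longrightarrow> K \<noteq> {} \<Longrightarrow> integrable sphere_measure (support_fun K)"
  by (intro integrable_sphere_measure continuous_on_support_fun)

lemma first_intrinsic_volume_sum:
  fixes S :: "'i \<Rightarrow> 'a::euclidean_space set"
  assumes "finite J" "\<And>j. j \<in> J \<Longrightarrow> compact (S j) \<and> S j \<noteq> {}"
  shows "first_intrinsic_volume (\<Sum>j\<in>J. S j) = (\<Sum>j\<in>J. first_intrinsic_volume (S j))"
proof -
  have "(LINT u|sphere_measure. support_fun (\<Sum>j\<in>J. S j) u)
      = (LINT u|sphere_measure. (\<Sum>j\<in>J. support_fun (S j) u))"
    by (simp add: support_fun_sum[OF assms] cong: Bochner_Integration.integral_cong)
  also have "\<dots> = (\<Sum>j\<in>J. LINT u|sphere_measure. support_fun (S j) u)"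
    using assms by (intro Bochner_Integration.integral_sum integrable_support_fun) auto
  finally show ?thesis by (simp add: first_intrinsic_volume_def sum_divide_distrib)
qed

text \<open>Spherical measure is finite, so support functions that are uniformly close on the sphere
  have close integrals. This yields continuity under Hausdorff limits.\<close>

lemma first_intrinsic_volume_diff_le:
  fixes A B :: "'a::euclidean_space set"
  assumes "compact A" "A \<noteq> {}" "compact B" "B \<noteq> {}"
    and "\<And>u. norm u = 1 \<Longrightarrow> \<bar>support_fun A u - support_fun B u\<bar> \<le> d"
  shows "\<bar>first_intrinsic_volume A - first_intrinsic_volume B\<bar>
    \<le> measure (sphere_measure :: 'a measure) (sphere 0 1) / unit_ball_vol (real (DIM('a) - 1)) * d"
proof -
  interpret finite_measure "sphere_measure :: 'a measure" by (rule finite_measure_sphere_measure)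
  let ?I = "\<lambda>K. LINT u|sphere_measure. support_fun K (u::'a)"
  have "\<bar>?I A - ?I B\<bar> = \<bar>LINT u|sphere_measure. support_fun A u - support_fun B u\<bar>"
    using assms by (simp add: integrable_support_fun)
  also have "\<dots> \<le> (LINT u|sphere_measure. \<bar>support_fun A u - support_fun B u\<bar>)"
    by (rule integral_abs_bound)
  also have "\<dots> \<le> (LINT u|(sphere_measure :: 'a measure). d)"
    using assms by (intro integral_mono) (auto simp: integrable_support_fun space_sphere_measure)
  also have "\<dots> = measure (sphere_measure :: 'a measure) (sphere 0 1) * d"
    by (simp add: space_sphere_measure)
  finally show ?thesis
    by (simp add: first_intrinsic_volume_def diff_divide_distrib[symmetric] divide_right_mono abs_divide)
qed

lemma first_intrinsic_volume_mono:
  fixes A B :: "'a::euclidean_space set"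
  assumes "compact A" "A \<noteq> {}" "compact B" "B \<noteq> {}"
    and "\<And>u. support_fun A u \<le> support_fun B u"
  shows "first_intrinsic_volume A \<le> first_intrinsic_volume B"
  unfolding first_intrinsic_volume_def
  using assms by (intro divide_right_mono integral_mono) (auto simp: integrable_support_fun)

text \<open>A point of one set outside the other would be strictly separated from it by a
  hyperplane, and the support functions would differ at a normal vector.\<close>

lemma compact_convex_eq_support_fun:
  fixes A B :: "'a::euclidean_space set"
  assumes "compact A" "convex A" "A \<noteq> {}" "compact B" "convex B" "B \<noteq> {}"
    and eq: "\<And>u. support_fun A u = support_fun B u"
  shows "A = B"
proof -
  have *: "A \<subseteq> B" if "compact A" and B: "compact B" "convex B" "B \<noteq> {}"
    and eq: "\<And>u. support_fun A u = support_fun B u" for A B :: "'a set"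
  proof
    fix z assume "z \<in> A"
    show "z \<in> B"
    proof (rule ccontr)
      assume "z \<notin> B"
      then obtain a b where ab: "a \<bullet> z < b" "\<forall>x\<in>B. b < a \<bullet> x"
        using separating_hyperplane_closed_point[OF B(2) compact_imp_closed[OF B(1)]] by blast
      have "support_fun B (- a) \<le> - b"
        using ab that by (intro support_fun_least) (auto intro: less_imp_le)
      moreover have "(- a) \<bullet> z \<le> support_fun A (- a)"
        using \<open>z \<in> A\<close> that(1) by (intro support_fun_upper)
      ultimately show False using ab eq[of "- a"] by simp
    qed
  qed
  show ?thesis
    using *[OF assms(1,4,5,6) eq] *[OF assms(4,1,2,3) eq[symmetric]] by (rule subset_antisym)
qed

section \<open>Hausdorff distance and Hausdorff limits\<close>

lemma infdist_le_hausdorff_dist: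
  fixes A B :: "'a::heine_borel set"
  assumes "compact A" "compact B" "x \<in> A"
  shows "infdist x B \<le> hausdorff_dist A B"
proof -
  have "bdd_above ((\<lambda>x. infdist x B) ` A)"
    using assms by (intro bounded_imp_bdd_above compact_imp_bounded compact_continuous_image continuous_intros)
  then have "infdist x B \<le> (SUP x\<in>A. infdist x B)"
    using assms by (intro cSUP_upper)
  then show "infdist x B \<le> hausdorff_dist A B"
    by (simp add: hausdorff_dist_def)
qed

lemma hausdorff_dist_commute: "hausdorff_dist A B = hausdorff_dist B A"
  by (simp add: hausdorff_dist_def max.commute)

lemma hausdorff_dist_point:
  fixes A B :: "'a::heine_borel set"
  assumes "compact A" "compact B" "B \<noteq> {}" "x \<in> A"
  obtains y where "y \<in> B" "dist x y \<le> hausdorff_dist A B"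
proof -
  obtain y where "y \<in> B" "infdist x B = dist x y"
    using infdist_attains_inf[of B x] assms compact_imp_closed by blast
  then show thesis
    using that infdist_le_hausdorff_dist[OF assms(1,2,4)] by simp
qed

text \<open>Each point of one set has a point of the other within the Hausdorff distance, and this
  move changes the functional by at most that distance times \<open>norm x\<close>.\<close>

lemma support_fun_diff_le_hausdorff_dist:
  fixes A B :: "'a::euclidean_space set"
  assumes "compact A" "A \<noteq> {}" "compact B" "B \<noteq> {}"
  shows "\<bar>support_fun A x - support_fun B x\<bar> \<le> hausdorff_dist A B * norm x"
proof -
  have "support_fun A x \<le> support_fun B x + hausdorff_dist A B * norm x"
    if "compact A" "A \<noteq> {}" "compact B" "B \<noteq> {}" for A B :: "'a set"
  proof (rule support_fun_least)
    fix y assume "y \<in> A"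
    with that obtain z where z: "z \<in> B" "dist y z \<le> hausdorff_dist A B"
      using hausdorff_dist_point[of A B y] by blast
    have "x \<bullet> y = x \<bullet> z + x \<bullet> (y - z)" by (simp add: inner_diff_right)
    also have "x \<bullet> (y - z) \<le> norm x * norm (y - z)" by (rule norm_cauchy_schwarz)
    also have "\<dots> \<le> norm x * hausdorff_dist A B"
      using z by (intro mult_left_mono) (auto simp: dist_norm)
    finally show "x \<bullet> y \<le> support_fun B x + hausdorff_dist A B * norm x"
      using support_fun_upper[OF that(3) z(1), of x] by (simp add: mult.commute)
  qed fact
  from this[OF assms] this[OF assms(3,4,1,2)] show ?thesis
    by (simp add: hausdorff_dist_commute[of B A] abs_le_iff)
qed

text \<open>The endpoints are moved into \<open>Z k\<close>, combined there, and the result is moved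
  back to \<open>K\<close>. Both moves displace the convex combination by at most the Hausdorff
  distance, whence the factor 2.\<close>

lemma convex_hausdorff_limit:
  fixes K :: "'a::euclidean_space set"
  assumes K: "compact K" "K \<noteq> {}"
    and Z: "\<And>k. compact (Z k)" "\<And>k. convex (Z k)" "\<And>k. Z k \<noteq> {}"
    and lim: "(\<lambda>k. hausdorff_dist (Z k) K) \<longlonglongrightarrow> 0"
  shows "convex K"
proof (rule convexI)
  fix x y u v assume xy: "x \<in> K" "y \<in> K" and uv: "0 \<le> u" "0 \<le> v" "u + v = (1::real)"
  let ?z = "u *\<^sub>R x + v *\<^sub>R y"
  have "infdist ?z K \<le> 2 * hausdorff_dist (Z k) K" for k
  proof -
    let ?d = "hausdorff_dist (Z k) K"
    obtain a where a: "a \<in> Z k" "dist x a \<le> ?d"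
      using hausdorff_dist_point[OF K(1) Z(1,3) xy(1), of k] hausdorff_dist_commute[of K "Z k"] by auto
    obtain b where b: "b \<in> Z k" "dist y b \<le> ?d"
      using hausdorff_dist_point[OF K(1) Z(1,3) xy(2), of k] hausdorff_dist_commute[of K "Z k"] by auto
    let ?c = "u *\<^sub>R a + v *\<^sub>R b"
    have "?c \<in> Z k" using a b uv Z(2) by (simp add: convexD)
    then obtain w where w: "w \<in> K" "dist ?c w \<le> ?d"
      using hausdorff_dist_point[OF Z(1)[of k] K, of ?c] by blast
    have "?z - ?c = u *\<^sub>R (x - a) + v *\<^sub>R (y - b)" by (simp add: algebra_simps)
    then have "dist ?z ?c \<le> u * dist x a + v * dist y b"
      using norm_triangle_ineq[of "u *\<^sub>R (x - a)" "v *\<^sub>R (y - b)"] uv by (simp add: dist_norm)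
    also have "\<dots> \<le> u * ?d + v * ?d" using a b uv by (intro add_mono mult_left_mono) auto
    also have "\<dots> = ?d" using uv by (metis distrib_right mult_1)
    finally have "dist ?z w \<le> 2 * ?d" using w(2) dist_triangle[of ?z w ?c] by linarith
    then show ?thesis using infdist_le[OF w(1)] order_trans by blast
  qed
  moreover have "(\<lambda>k. 2 * hausdorff_dist (Z k) K) \<longlonglongrightarrow> 0"
    using tendsto_mult_left[OF lim, of 2] by simp
  ultimately have "infdist ?z K \<le> 0" by (metis LIMSEQ_le_const)
  then show "?z \<in> K"
    using K in_closed_iff_infdist_zero[of K ?z] infdist_nonneg[of ?z K] compact_imp_closed by auto
qed

section \<open>Coordinate shadows and sign vectors\<close>

text \<open>Projections stay inside the same \<open>real ^ 'n\<close>, so a single \<open>c\<close>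
  serves for segments and for their shadows.\<close>

lemma first_intrinsic_volume_segment_const:
  obtains c :: real where "0 < c"
    "\<And>a b :: real ^ 'n. first_intrinsic_volume (closed_segment a b) = c * norm (b - a)"
proof
  define e :: "real ^ 'n" where "e = axis undefined 1"
  have e: "norm e = 1" by (simp add: e_def norm_axis_1)
  let ?c = "half_width_integral e / unit_ball_vol (real (DIM(real ^ 'n) - 1))"
  show "0 < ?c" using half_width_integral_pos[OF e] by simp
  fix a b :: "real ^ 'n"
  have "(LINT x|sphere_measure. support_fun (closed_segment a b) x)
      = (LINT x|sphere_measure. a \<bullet> x) + half_width_integral (b - a)"
    unfolding support_fun_closed_segment half_width_integral_def
    by (intro Bochner_Integration.integral_add integrable_sphere_measure continuous_intros)
  then show "first_intrinsic_volume (closed_segment a b) = ?c * norm (b - a)"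
    by (simp add: first_intrinsic_volume_def LINT_sphere_inner_eq_0 half_width_integral_eq[OF e, of "b - a"])
qed

section \<open>Coordinate projections\<close>

definition drop_coord :: "'n::finite \<Rightarrow> real ^ 'n \<Rightarrow> real ^ 'n" where
  "drop_coord i x = x - (x \<bullet> axis i 1) *\<^sub>R axis i 1"

lemma coord_proj_eq: "coord_proj i K = drop_coord i ` K"
  by (simp add: coord_proj_def drop_coord_def)

lemma linear_drop_coord: "linear (drop_coord i)"
  by (auto intro!: linearI simp: drop_coord_def algebra_simps inner_add_left)

text \<open>An orthogonal projection is self-adjoint; hence the support function of a shadow can be
  evaluated on the original set.\<close>

lemma inner_drop_coord: "drop_coord i x \<bullet> y = x \<bullet> drop_coord i y"
  by (simp add: drop_coord_def inner_diff_left inner_diff_right inner_commute mult.commute)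

lemma norm_drop_coord: "(norm (drop_coord i x))\<^sup>2 = (norm x)\<^sup>2 - (x $ i)\<^sup>2"
  unfolding power2_norm_eq_inner
  by (simp add: drop_coord_def inner_diff_left inner_diff_right inner_axis inner_axis' power2_eq_square)

lemma norm_drop_coord_le: "norm (drop_coord i x) \<le> norm x"
  by (rule power2_le_imp_le) (simp_all add: norm_drop_coord)

lemma support_fun_coord_proj: "support_fun (coord_proj i K) x = support_fun K (drop_coord i x)"
  by (simp add: support_fun_def coord_proj_eq image_image inner_drop_coord)

lemma compact_coord_proj: "compact K \<Longrightarrow> compact (coord_proj i K)"
  unfolding coord_proj_eq
  by (intro compact_continuous_image linear_continuous_on)
    (simp_all add: linear_drop_coord flip: linear_conv_bounded_linear)

lemma coord_proj_nonempty: "K \<noteq> {} \<Longrightarrow> coord_proj i K \<noteq> {}"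
  by (simp add: coord_proj_eq)

lemma coord_proj_sum: "coord_proj i (\<Sum>j\<in>J. S j) = (\<Sum>j\<in>J. coord_proj i (S j))"
proof -
  have "coord_proj i A + coord_proj i B = coord_proj i (A + B)" for A B
  proof (intro equalityI subsetI)
    fix x assume "x \<in> coord_proj i A + coord_proj i B"
    then obtain a b where "a \<in> A" "b \<in> B" "x = drop_coord i a + drop_coord i b"
      by (auto simp: coord_proj_eq elim!: set_plus_elim)
    then show "x \<in> coord_proj i (A + B)"
      unfolding coord_proj_eq
      by (intro image_eqI[of _ _ "a + b"] set_plus_intro) (simp_all add: linear_add[OF linear_drop_coord])
  next
    fix x assume "x \<in> coord_proj i (A + B)"
    then obtain a b where "a \<in> A" "b \<in> B" "x = drop_coord i (a + b)"
      by (auto simp: coord_proj_eq elim!: set_plus_elim)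
    then show "x \<in> coord_proj i A + coord_proj i B"
      by (auto simp: coord_proj_eq linear_add[OF linear_drop_coord])
  qed
  moreover have "coord_proj i {0} = {0}"
    by (simp add: coord_proj_eq drop_coord_def)
  ultimately show ?thesis
    using sum_set_linear[of "coord_proj i" S J] by (simp add: o_def)
qed

lemma coord_proj_closed_segment:
  "coord_proj i (closed_segment a b) = closed_segment (drop_coord i a) (drop_coord i b)"
  unfolding coord_proj_eq by (rule closed_segment_linear_image[OF linear_drop_coord, symmetric])

text \<open>Collecting the shadow lengths in one vector turns the sum of squares over
  \<open>i\<close> into a Euclidean norm, to which the triangle inequality applies.\<close>

definition shadow_norms :: "real ^ 'n \<Rightarrow> real ^ 'n::finite" where
  "shadow_norms v = (\<chi> i. norm (drop_coord i v))"

lemma shadow_norms_nth: "shadow_norms v $ i = norm (drop_coord i v)"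
  by (simp add: shadow_norms_def)

lemma power2_norm_vec: "(norm (x :: real ^ 'n))\<^sup>2 = (\<Sum>i\<in>UNIV. (x $ i)\<^sup>2)"
  unfolding power2_norm_eq_inner by (simp add: inner_vec_def power2_eq_square)

text \<open>The square of each coordinate of \<open>v\<close> is missing from exactly one of the
  squared shadow lengths.\<close>

lemma power2_norm_shadow_norms:
  "(norm (shadow_norms (v :: real ^ 'n)))\<^sup>2 = (real CARD('n) - 1) * (norm v)\<^sup>2"
proof -
  have "(norm (shadow_norms v))\<^sup>2 = (\<Sum>i\<in>UNIV. (norm v)\<^sup>2 - (v $ i)\<^sup>2)"
    unfolding power2_norm_vec[of "shadow_norms v"] by (simp add: shadow_norms_nth norm_drop_coord)
  also have "\<dots> = (real CARD('n) - 1) * (norm v)\<^sup>2"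
    by (simp add: sum_subtractf power2_norm_vec algebra_simps)
  finally show ?thesis .
qed

text \<open>The inequality for zonotopes, apart from the common factor \<open>c\<^sup>2\<close>: it
  is the triangle inequality for vectors whose norms are a fixed multiple of the edge
  lengths.\<close>

lemma norm_sum_shadow_norms:
  fixes v :: "'i \<Rightarrow> real ^ 'n"
  shows "(norm (\<Sum>j\<in>J. shadow_norms (v j)))\<^sup>2 \<le> (real CARD('n) - 1) * (\<Sum>j\<in>J. norm (v j))\<^sup>2"
proof -
  have "1 \<le> real CARD('n)" using one_le_card_finite[where 'a = 'n] by linarith
  have n: "norm (shadow_norms x) = sqrt (real CARD('n) - 1) * norm x" for x :: "real ^ 'n"
    by (rule power2_eq_imp_eq)
      (use \<open>1 \<le> real CARD('n)\<close> in \<open>simp_all add: power2_norm_shadow_norms power_mult_distrib\<close>)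
  have "norm (\<Sum>j\<in>J. shadow_norms (v j)) \<le> sqrt (real CARD('n) - 1) * (\<Sum>j\<in>J. norm (v j))"
    using norm_sum[of "\<lambda>j. shadow_norms (v j)" J] by (simp add: n sum_distrib_left)
  then have "(norm (\<Sum>j\<in>J. shadow_norms (v j)))\<^sup>2 \<le> (sqrt (real CARD('n) - 1) * (\<Sum>j\<in>J. norm (v j)))\<^sup>2"
    by (intro power_mono) auto
  then show ?thesis using \<open>1 \<le> real CARD('n)\<close> by (simp add: power_mult_distrib)
qed

section \<open>Sign patterns\<close>

definition sign_vec :: "real ^ 'n \<Rightarrow> real ^ 'n::finite" where
  "sign_vec v = (\<chi> i. if 0 \<le> v $ i then 1 else - 1)"

lemma sign_vec_in: "sign_vec v \<in> sign_vectors"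
  by (simp add: sign_vec_def sign_vectors_def)

lemma finite_sign_vectors: "finite (sign_vectors :: (real ^ 'n) set)"
proof -
  have "sign_vectors \<subseteq> (\<lambda>S. \<chi> i. if i \<in> S then 1 else - 1) ` (UNIV :: 'n set set)"
  proof
    fix \<epsilon> :: "real ^ 'n" assume "\<epsilon> \<in> sign_vectors"
    then have "\<epsilon> = (\<chi> i. if i \<in> {i. \<epsilon> $ i = 1} then 1 else - 1)"
      by (auto simp: sign_vectors_def vec_eq_iff)
    then show "\<epsilon> \<in> (\<lambda>S. \<chi> i. if i \<in> S then 1 else - 1) ` (UNIV :: 'n set set)" by blast
  qed
  then show ?thesis by (rule finite_subset) simp
qed

definition signed :: "real ^ 'n \<Rightarrow> real ^ 'n \<Rightarrow> real ^ 'n::finite" where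
  "signed u \<epsilon> = (\<chi> i. \<epsilon> $ i * u $ i)"

lemma signed_nth: "signed u \<epsilon> $ i = \<epsilon> $ i * u $ i"
  by (simp add: signed_def)

lemma power2_sign: "\<epsilon> \<in> sign_vectors \<Longrightarrow> (\<epsilon> $ i)\<^sup>2 = 1"
  by (auto simp: sign_vectors_def) (metis power2_minus power_one)

lemma norm_signed:
  assumes "\<epsilon> \<in> sign_vectors"
  shows "norm (signed u \<epsilon>) = norm u"
  by (rule power2_eq_imp_eq)
    (simp_all add: power2_norm_vec signed_nth power_mult_distrib power2_sign[OF assms])

text \<open>Shadow lengths depend only on the squares of the coordinates. All edges of a sign
  zonotope thus have shadow vectors in one direction, the equality case of the triangle
  inequality.\<close>

lemma shadow_norms_signed:
  assumes "\<epsilon> \<in> sign_vectors"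
  shows "shadow_norms (r *\<^sub>R signed u \<epsilon>) = \<bar>r\<bar> *\<^sub>R shadow_norms u"
proof -
  have "(norm (drop_coord i (r *\<^sub>R signed u \<epsilon>)))\<^sup>2 = (\<bar>r\<bar> * norm (drop_coord i u))\<^sup>2" for i
    by (simp add: norm_drop_coord norm_signed[OF assms] signed_nth power_mult_distrib
        power2_sign[OF assms] algebra_simps)
  then have "norm (drop_coord i (r *\<^sub>R signed u \<epsilon>)) = \<bar>r\<bar> * norm (drop_coord i u)" for i
    by (rule power2_eq_imp_eq) auto
  then show ?thesis by (simp add: vec_eq_iff shadow_norms_nth)
qed

text \<open>The signs are those of \<open>v\<close> itself, so only absolute values are compared; at
  a zero coordinate either sign would do.\<close>

lemma abs_diff_sign_vec: "\<bar>(v - norm v *\<^sub>R signed u (sign_vec v)) $ i\<bar> = \<bar>\<bar>v $ i\<bar> - norm v * u $ i\<bar>"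
  by (auto simp: signed_nth sign_vec_def)

text \<open>
  If the coordinate shadows of \<open>v\<close> are nearly in the proportions \<open>F\<close>, the Cauchy-Schwarz defect
  on the right controls the distance of \<open>v\<close> from the nearest of the vectors
  \<open>\<bar>v\<bar> (\<epsilon>\<^sub>1 u\<^sub>1, \<dots>, \<epsilon>\<^sub>n u\<^sub>n)\<close>.
\<close>

lemma dist_signed_le:
  fixes v u F :: "real ^ 'n"
  assumes A: "0 < A" and F: "\<And>i. 0 \<le> F $ i" "\<And>i. F $ i \<le> A"
    and eq: "(norm F)\<^sup>2 = (real CARD('n) - 1) * A\<^sup>2"
    and u: "\<And>i. u $ i = sqrt (1 - (F $ i / A)\<^sup>2)"
    and \<delta>: "0 < \<delta>"
  shows "norm (v - norm v *\<^sub>R signed u (sign_vec v))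
    \<le> \<delta> * norm v + 8 * (real CARD('n))\<^sup>2 / \<delta> ^ 3 * ((real CARD('n) - 1) * norm v - (shadow_norms v \<bullet> F) / A)"
proof -
  let ?n = "real CARD('n)" and ?f = "shadow_norms v" and ?r = "norm v"
  define E where "E = (?n - 1) * ?r - (?f \<bullet> F) / A"
  \<comment> \<open>By \<open>eq\<close> the vectors \<open>?f\<close> and
    \<open>(?r / A) *\<^sub>R F\<close> have the same norm, so the square of their distance is
    linear in the defect \<open>E\<close>.\<close>
  define g where "g = ?f - (?r / A) *\<^sub>R F"
  define y where "y = norm (v - ?r *\<^sub>R signed u (sign_vec v))"
  have g2: "(norm g)\<^sup>2 = 2 * ?r * E"
  proof -
    have "(norm g)\<^sup>2 = (norm ?f)\<^sup>2 - 2 * (?r / A) * (?f \<bullet> F) + (?r / A)\<^sup>2 * (norm F)\<^sup>2"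
      unfolding g_def power2_norm_eq_inner
      by (simp add: inner_diff_left inner_diff_right inner_commute[of F ?f] power2_eq_square algebra_simps)
    also have "\<dots> = 2 * ?r * E"
      using A unfolding E_def power2_norm_shadow_norms eq
      by (simp add: field_simps power2_eq_square)
    finally show ?thesis .
  qed
  have u2: "0 \<le> u $ i" "(u $ i)\<^sup>2 = 1 - (F $ i / A)\<^sup>2" for i
  proof -
    have "F $ i / A \<le> 1" "0 \<le> F $ i / A" using A F[of i] by auto
    then have "(F $ i / A)\<^sup>2 \<le> 1" by (simp add: power_le_one)
    then show "0 \<le> u $ i" "(u $ i)\<^sup>2 = 1 - (F $ i / A)\<^sup>2" by (simp_all add: u)
  qed
  \<comment> \<open>For nonnegative numbers \<open>(a - b)\<^sup>2\<close> is at most the absolute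
    value of \<open>a\<^sup>2 - b\<^sup>2\<close>. By Pythagoras, \<open>?a\<close> and
    \<open>?p\<close> as well as \<open>?b\<close> and \<open>?q\<close> have squares adding up to
    \<open>?r\<^sup>2\<close>, so the difference of squares passes to the shadows.\<close>
  have comp: "((v - ?r *\<^sub>R signed u (sign_vec v)) $ i)\<^sup>2 \<le> 2 * ?r * norm g" for i
  proof -
    let ?a = "\<bar>v $ i\<bar>" and ?b = "?r * u $ i" and ?p = "?f $ i" and ?q = "?r / A * F $ i"
    have b: "0 \<le> ?b" using u2 by simp
    have q: "0 \<le> ?q" using A F(1)[of i] by simp
    have q': "?q \<le> ?r"
      using A F(2)[of i] mult_left_mono[of "F $ i / A" 1 ?r] by simp
    have p: "0 \<le> ?p" "?p \<le> ?r" by (simp_all add: shadow_norms_nth norm_drop_coord_le)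
    have "((v - ?r *\<^sub>R signed u (sign_vec v)) $ i)\<^sup>2 = \<bar>?a - ?b\<bar> * \<bar>?a - ?b\<bar>"
      unfolding abs_diff_sign_vec[symmetric] by (simp only: abs_mult_self_eq power2_eq_square)
    also have "\<dots> \<le> \<bar>?a - ?b\<bar> * (?a + ?b)"
      using b by (intro mult_left_mono) auto
    also have "\<dots> = \<bar>(?a - ?b) * (?a + ?b)\<bar>"
      using b by (simp add: abs_mult)
    also have "(?a - ?b) * (?a + ?b) = (v $ i)\<^sup>2 - ?r\<^sup>2 * (u $ i)\<^sup>2"
      by (simp add: algebra_simps power2_eq_square)
    also have "\<dots> = ?q\<^sup>2 - ?p\<^sup>2"
      by (simp add: u2 shadow_norms_nth norm_drop_coord power_mult_distrib power_divide algebra_simps)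
    also have "\<bar>\<dots>\<bar> = \<bar>?p - ?q\<bar> * (?p + ?q)"
    proof -
      have "?q\<^sup>2 - ?p\<^sup>2 = - ((?p - ?q) * (?p + ?q))" by (simp add: algebra_simps power2_eq_square)
      moreover have "\<bar>?p + ?q\<bar> = ?p + ?q" using p q by linarith
      ultimately show ?thesis by (simp only: abs_minus abs_mult)
    qed
    also have "\<dots> \<le> norm g * (?r + ?r)"
    proof (rule mult_mono)
      show "\<bar>?p - ?q\<bar> \<le> norm g"
        using component_le_norm_cart[of g i] by (simp add: g_def)
    qed (use p q q' in auto)
    finally show ?thesis by (simp add: mult.commute)
  qed
  have "y\<^sup>2 \<le> (\<Sum>i\<in>(UNIV :: 'n set). 2 * ?r * norm g)"
    unfolding y_def power2_norm_vec by (rule sum_mono) (rule comp)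
  then have y2: "y\<^sup>2 \<le> ?n * (2 * ?r * norm g)" by simp
  \<comment> \<open>Squaring once more brings in \<open>g2\<close> and makes the bound linear in
    \<open>E\<close>; the 8 is the square of 2 times the 2 of \<open>g2\<close>.\<close>
  have "y ^ 4 = (y\<^sup>2)\<^sup>2" by simp
  also have "\<dots> \<le> (?n * (2 * ?r * norm g))\<^sup>2"
    using y2 by (intro power_mono) auto
  also have "\<dots> = 8 * ?n\<^sup>2 * E * ?r ^ 3"
    by (simp add: power_mult_distrib g2) (simp add: power2_eq_square power3_eq_cube)
  finally have y4: "y ^ 4 \<le> 8 * ?n\<^sup>2 * E * ?r ^ 3" .
  \<comment> \<open>If \<open>y\<close> exceeds \<open>\<delta> * ?r\<close>, three of the four
    factors \<open>y\<close> can be replaced by \<open>\<delta> * ?r\<close> and the power of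
    \<open>?r\<close> cancels. The resulting bound is linear in \<open>E\<close>, which allows
    summation over edges.\<close>
  show ?thesis
  proof (cases "y \<le> \<delta> * ?r \<or> ?r = 0")
    case True
    show ?thesis
    proof (cases "?r = 0")
      case True
      then have "v = 0" by simp
      then show ?thesis by (simp add: shadow_norms_def drop_coord_def zero_vec_def[symmetric])
    next
      case False
      then have r: "0 < ?r" by simp
      have "0 \<le> 2 * ?r * E" using g2 zero_le_power2 by metis
      then have "0 \<le> E" using r by (simp add: zero_le_mult_iff)
      then have "0 \<le> 8 * ?n\<^sup>2 / \<delta> ^ 3 * E" using \<delta> by simp
      then show ?thesis using True False unfolding y_def E_def by linarith
    qed
  next
    case False
    then have r: "0 < ?r" and y: "\<delta> * ?r < y" by auto
    have "(\<delta> * ?r) ^ 3 \<le> y ^ 3" using y r \<delta> by (intro power_mono) auto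
    then have "y * (\<delta> * ?r) ^ 3 \<le> y * y ^ 3" by (rule mult_left_mono) (simp add: y_def)
    then have "y * (\<delta> ^ 3 * ?r ^ 3) \<le> y * y ^ 3" by (simp only: power_mult_distrib)
    also have "\<dots> = y ^ 4" by (simp add: power_numeral_reduce)
    also note y4
    finally have "(y * \<delta> ^ 3) * ?r ^ 3 \<le> (8 * ?n\<^sup>2 * E) * ?r ^ 3" by (simp add: ac_simps)
    then have "y * \<delta> ^ 3 \<le> 8 * ?n\<^sup>2 * E" using r by (simp add: mult_le_cancel_right)
    then have "y \<le> 8 * ?n\<^sup>2 / \<delta> ^ 3 * E" using \<delta> by (simp add: field_simps)
    moreover have "0 \<le> \<delta> * ?r" using \<delta> by simp
    ultimately show ?thesis unfolding y_def E_def by linarith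
  qed
qed

text \<open>The bound of \<open>dist_signed_le\<close> is linear in \<open>norm v\<close> and
  \<open>shadow_norms v\<close>, so its sum converges by \<open>limA\<close> and
  \<open>limF\<close>. By \<open>eq\<close> the defects vanish in the limit, and only
  \<open>\<delta> * A\<close> remains.\<close>

lemma sum_dist_signed_tendsto_0:
  fixes v :: "nat \<Rightarrow> nat \<Rightarrow> real ^ 'n" and F u :: "real ^ 'n"
  assumes A: "0 < A" and F: "\<And>i. 0 \<le> F $ i" "\<And>i. F $ i \<le> A"
    and eq: "(norm F)\<^sup>2 = (real CARD('n) - 1) * A\<^sup>2"
    and u: "\<And>i. u $ i = sqrt (1 - (F $ i / A)\<^sup>2)"
    and limA: "(\<lambda>k. \<Sum>j<m k. norm (v k j)) \<longlonglongrightarrow> A"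
    and limF: "(\<lambda>k. \<Sum>j<m k. shadow_norms (v k j)) \<longlonglongrightarrow> F"
  shows "(\<lambda>k. \<Sum>j<m k. norm (v k j - norm (v k j) *\<^sub>R signed u (sign_vec (v k j)))) \<longlonglongrightarrow> 0"
    (is "?Y \<longlonglongrightarrow> 0")
proof (rule tendstoI)
  fix e :: real assume e: "0 < e"
  \<comment> \<open>Chosen so that the remaining term \<open>\<delta> * A\<close> is
    \<open>e / 2\<close>.\<close>
  define \<delta> where "\<delta> = e / (2 * A)"
  have \<delta>: "0 < \<delta>" using e A by (simp add: \<delta>_def)
  let ?n = "real CARD('n)"
  let ?C = "8 * ?n\<^sup>2 / \<delta> ^ 3"
  let ?G = "\<lambda>k. \<delta> * (\<Sum>j<m k. norm (v k j)) + ?C * ((?n - 1) * (\<Sum>j<m k. norm (v k j))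
      - ((\<Sum>j<m k. shadow_norms (v k j)) \<bullet> F) / A)"
  have "?G \<longlonglongrightarrow> \<delta> * A + ?C * ((?n - 1) * A - (F \<bullet> F) / A)"
    using A by (intro tendsto_intros limA limF) simp
  moreover have "\<delta> * A + ?C * ((?n - 1) * A - (F \<bullet> F) / A) = e / 2"
    using A eq by (simp add: power2_norm_eq_inner[symmetric] power2_eq_square \<delta>_def)
  ultimately have "?G \<longlonglongrightarrow> e / 2" by (simp only:)
  then have "\<forall>\<^sub>F k in sequentially. ?G k < e"
    using e by (intro order_tendstoD(2)[of ?G "e / 2"]) auto
  moreover have "?Y k \<le> ?G k" for k
  proof -
    have "?Y k \<le> (\<Sum>j<m k. \<delta> * norm (v k j)
        + ?C * ((?n - 1) * norm (v k j) - (shadow_norms (v k j) \<bullet> F) / A))"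
      by (intro sum_mono dist_signed_le[OF A F eq u \<delta>])
    also have "\<dots> = ?G k"
      by (simp add: sum.distrib sum_subtractf sum_distrib_left[symmetric] sum_divide_distrib[symmetric] inner_sum_left)
    finally show ?thesis .
  qed
  ultimately have "\<forall>\<^sub>F k in sequentially. ?Y k < e"
    by (elim eventually_mono) (rule le_less_trans)
  then show "\<forall>\<^sub>F k in sequentially. dist (?Y k) 0 < e"
    by (simp add: dist_real_def sum_nonneg)
qed

text \<open>Bolzano-Weierstrass is applied to one index after another; passing to a further
  subsequence keeps the limits already found.\<close>

lemma finite_bounded_subsequence:
  fixes a :: "nat \<Rightarrow> 's \<Rightarrow> real"
  assumes "finite S" "\<And>s. s \<in> S \<Longrightarrow> bounded (range (\<lambda>k. a k s))"
  obtains r l where "strict_mono r" "\<And>s. s \<in> S \<Longrightarrow> (\<lambda>k. a (r k) s) \<longlonglongrightarrow> l s"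
proof -
  have "\<exists>r l. strict_mono r \<and> (\<forall>s\<in>S. (\<lambda>k. a (r k) s) \<longlonglongrightarrow> l s)"
    using assms
  proof (induction S rule: finite_induct)
    case empty
    then show ?case using strict_mono_id by auto
  next
    case (insert s S)
    then obtain r l where r: "strict_mono r" and l: "\<forall>s\<in>S. (\<lambda>k. a (r k) s) \<longlonglongrightarrow> l s" by auto
    have "bounded (range (\<lambda>k. a (r k) s))"
      using insert.prems[of s] by (rule bounded_subset) auto
    then obtain l' r' where r': "strict_mono r'" "((\<lambda>k. a (r k) s) \<circ> r') \<longlonglongrightarrow> l'"
      using bounded_imp_convergent_subsequence by blast
    have "(\<lambda>k. a ((r \<circ> r') k) x) \<longlonglongrightarrow> (l(s := l')) x" if "x \<in> insert s S" for x
    proof (cases "x = s")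
      case True
      then show ?thesis using r' by (simp add: o_def)
    next
      case False
      then show ?thesis
        using that l LIMSEQ_subseq_LIMSEQ[of "\<lambda>k. a (r k) x" "l x" r'] r'(1) by (auto simp: o_def)
    qed
    then show ?case using strict_mono_o[OF r r'(1)] by blast
  qed
  then show thesis using that by blast
qed

section \<open>Zonoids\<close>

lemma zonotope_properties:
  assumes "zonotope Z"
  shows "compact Z" "convex Z" "Z \<noteq> {}"
proof -
  obtain m a b where Z: "Z = (\<Sum>i<(m::nat). closed_segment (a i) (b i))"
    using assms unfolding zonotope_def by blast
  show "compact Z" unfolding Z by (rule compact_set_sum) simp
  show "convex Z" unfolding Z by (rule convex_set_sum) simp
  show "Z \<noteq> {}" unfolding Z by (rule set_sum_nonempty) simp
qed

text \<open>Convexity is what allows \<open>K\<close> to be recovered from its support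
  function.\<close>

lemma zonoid_convex:
  assumes "zonoid K"
  shows "convex K"
  using assms zonotope_properties convex_hausdorff_limit unfolding zonoid_def by metis

lemma first_intrinsic_volume_segments:
  fixes a b :: "'i \<Rightarrow> real ^ 'n"
  assumes c: "\<And>a b :: real ^ 'n. first_intrinsic_volume (closed_segment a b) = c * norm (b - a)"
    and "finite J"
  shows "first_intrinsic_volume (\<Sum>j\<in>J. closed_segment (a j) (b j)) = c * (\<Sum>j\<in>J. norm (b j - a j))"
    and "first_intrinsic_volume (coord_proj i (\<Sum>j\<in>J. closed_segment (a j) (b j)))
      = c * (\<Sum>j\<in>J. shadow_norms (b j - a j)) $ i"
proof -
  show "first_intrinsic_volume (\<Sum>j\<in>J. closed_segment (a j) (b j)) = c * (\<Sum>j\<in>J. norm (b j - a j))"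
    by (subst first_intrinsic_volume_sum) (simp_all add: c assms sum_distrib_left)
  show "first_intrinsic_volume (coord_proj i (\<Sum>j\<in>J. closed_segment (a j) (b j)))
      = c * (\<Sum>j\<in>J. shadow_norms (b j - a j)) $ i"
    by (subst coord_proj_sum, subst first_intrinsic_volume_sum)
      (simp_all add: coord_proj_closed_segment c assms sum_distrib_left shadow_norms_nth
        linear_diff[OF linear_drop_coord])
qed

text \<open>The error \<open>d\<close> is a parameter so that the Hausdorff distance of the original
  sets can also serve for their projections.\<close>

lemma tendsto_first_intrinsic_volume:
  fixes K :: "'a::euclidean_space set"
  assumes K: "compact K" "K \<noteq> {}" and Z: "\<And>k. compact (Z k)" "\<And>k. Z k \<noteq> {}"
    and d: "d \<longlonglongrightarrow> 0" "\<And>k u. norm u = 1 \<Longrightarrow> \<bar>support_fun (Z k) u - support_fun K u\<bar> \<le> d k"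
  shows "(\<lambda>k. first_intrinsic_volume (Z k)) \<longlonglongrightarrow> first_intrinsic_volume K"
proof -
  let ?C = "measure (sphere_measure :: 'a measure) (sphere 0 1) / unit_ball_vol (real (DIM('a) - 1))"
  have "norm (first_intrinsic_volume (Z k) - first_intrinsic_volume K) \<le> ?C * d k" for k
    using first_intrinsic_volume_diff_le[OF Z(1,2) K d(2)] by simp
  then have "\<forall>\<^sub>F k in sequentially. norm (first_intrinsic_volume (Z k) - first_intrinsic_volume K) \<le> ?C * d k"
    by (rule always_eventually[OF allI])
  moreover have "(\<lambda>k. ?C * d k) \<longlonglongrightarrow> 0"
    using tendsto_mult_left[OF d(1), of ?C] by simp
  ultimately have "(\<lambda>k. first_intrinsic_volume (Z k) - first_intrinsic_volume K) \<longlonglongrightarrow> 0"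
    by (rule Lim_null_comparison)
  then show ?thesis by (simp add: LIM_zero_iff)
qed

text \<open>Extracts from approximating zonotopes the data used later: edge vectors
  \<open>v k j\<close> and base points \<open>t k\<close>. The number \<open>m k\<close> of edges
  may grow, so only sums over all edges have limits here.\<close>

lemma zonoid_approximation:
  fixes K :: "(real ^ 'n) set"
  assumes K: "zonoid K" and "0 < c"
    and c: "\<And>a b :: real ^ 'n. first_intrinsic_volume (closed_segment a b) = c * norm (b - a)"
  obtains m :: "nat \<Rightarrow> nat" and t v where
    "\<And>x. (\<lambda>k. t k \<bullet> x + (\<Sum>j<m k. max 0 (v k j \<bullet> x))) \<longlonglongrightarrow> support_fun K x"
    "(\<lambda>k. \<Sum>j<m k. norm (v k j)) \<longlonglongrightarrow> first_intrinsic_volume K / c"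
    "(\<lambda>k. \<Sum>j<m k. shadow_norms (v k j)) \<longlonglongrightarrow> (\<chi> i. first_intrinsic_volume (coord_proj i K) / c)"
    "bounded (range t)"
proof -
  obtain Z where cK: "compact K" "K \<noteq> {}" and zZ: "\<And>k. zonotope (Z k)"
    and lim: "(\<lambda>k. hausdorff_dist (Z k) K) \<longlonglongrightarrow> 0"
    using K unfolding zonoid_def by auto
  note Z = zonotope_properties[OF zZ]
  obtain m :: "nat \<Rightarrow> nat" and a b where Zeq: "\<And>k. Z k = (\<Sum>j<m k. closed_segment (a k j) (b k j))"
    using zZ unfolding zonotope_def by metis
  define v where "v k j = b k j - a k j" for k j
  define t where "t k = (\<Sum>j<m k. a k j)" for k
  have near: "\<bar>support_fun (Z k) x - support_fun K x\<bar> \<le> hausdorff_dist (Z k) K * norm x" for k x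
    by (rule support_fun_diff_le_hausdorff_dist[OF Z(1,3) cK])
  have nonneg: "0 \<le> hausdorff_dist (Z k) K" for k
  proof -
    obtain x where "x \<in> Z k" using Z(3) by blast
    then show ?thesis
      using infdist_le_hausdorff_dist[OF Z(1) cK(1)] infdist_nonneg order_trans by blast
  qed
  have supp: "support_fun (Z k) x = t k \<bullet> x + (\<Sum>j<m k. max 0 (v k j \<bullet> x))" for k x
    unfolding Zeq by (subst support_fun_sum)
      (simp_all add: support_fun_closed_segment sum.distrib t_def v_def inner_sum_left)
  have 1: "(\<lambda>k. t k \<bullet> x + (\<Sum>j<m k. max 0 (v k j \<bullet> x))) \<longlonglongrightarrow> support_fun K x" for x
  proof -
    have "\<forall>\<^sub>F k in sequentially. norm (support_fun (Z k) x - support_fun K x) \<le> hausdorff_dist (Z k) K * norm x"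
      by (simp add: near)
    moreover have "(\<lambda>k. hausdorff_dist (Z k) K * norm x) \<longlonglongrightarrow> 0"
      using tendsto_mult_right[OF lim, of "norm x"] by simp
    ultimately have "(\<lambda>k. support_fun (Z k) x - support_fun K x) \<longlonglongrightarrow> 0"
      by (rule Lim_null_comparison)
    then show ?thesis by (simp add: supp LIM_zero_iff)
  qed
  have "(\<lambda>k. first_intrinsic_volume (Z k)) \<longlonglongrightarrow> first_intrinsic_volume K"
    by (rule tendsto_first_intrinsic_volume[OF cK Z(1,3) lim]) (metis near mult_1_right)
  then have "(\<lambda>k. c * (\<Sum>j<m k. norm (v k j)) / c) \<longlonglongrightarrow> first_intrinsic_volume K / c"
    unfolding Zeq first_intrinsic_volume_segments(1)[OF c finite_lessThan] v_def
    by (intro tendsto_divide tendsto_const) (use \<open>0 < c\<close> in auto)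
  then have 2: "(\<lambda>k. \<Sum>j<m k. norm (v k j)) \<longlonglongrightarrow> first_intrinsic_volume K / c"
    using \<open>0 < c\<close> by simp
  have "(\<lambda>k. (\<Sum>j<m k. shadow_norms (v k j)) $ i) \<longlonglongrightarrow> first_intrinsic_volume (coord_proj i K) / c" for i
  proof -
    have "(\<lambda>k. first_intrinsic_volume (coord_proj i (Z k))) \<longlonglongrightarrow> first_intrinsic_volume (coord_proj i K)"
    proof (rule tendsto_first_intrinsic_volume[OF _ _ _ _ lim])
      fix k and u :: "real ^ 'n" assume u: "norm u = 1"
      have "\<bar>support_fun (coord_proj i (Z k)) u - support_fun (coord_proj i K) u\<bar>
          \<le> hausdorff_dist (Z k) K * norm (drop_coord i u)"
        by (simp add: support_fun_coord_proj near)
      also have "\<dots> \<le> hausdorff_dist (Z k) K * norm u"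
        by (intro mult_left_mono norm_drop_coord_le nonneg)
      finally show "\<bar>support_fun (coord_proj i (Z k)) u - support_fun (coord_proj i K) u\<bar>
          \<le> hausdorff_dist (Z k) K" using u by simp
    qed (use cK Z in \<open>auto intro: compact_coord_proj simp: coord_proj_nonempty\<close>)
    then have "(\<lambda>k. c * (\<Sum>j<m k. shadow_norms (v k j)) $ i / c) \<longlonglongrightarrow> first_intrinsic_volume (coord_proj i K) / c"
      unfolding Zeq first_intrinsic_volume_segments(2)[OF c finite_lessThan] v_def
      by (intro tendsto_divide tendsto_const) (use \<open>0 < c\<close> in auto)
    then show ?thesis using \<open>0 < c\<close> by simp
  qed
  then have 3: "(\<lambda>k. \<Sum>j<m k. shadow_norms (v k j)) \<longlonglongrightarrow> (\<chi> i. first_intrinsic_volume (coord_proj i K) / c)"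
    by (intro vec_tendstoI) (simp only: vec_lambda_beta)
  \<comment> \<open>Each \<open>t k\<close> is itself a point of \<open>Z k\<close>, and these sets
    stay within bounded distance of the compact set \<open>K\<close>.\<close>
  have 4: "bounded (range t)"
  proof -
    have tZ: "t k \<in> Z k" for k
      unfolding t_def Zeq by (rule sum_mem_set_sum) simp
    obtain B where B: "\<And>k. norm (hausdorff_dist (Z k) K) \<le> B"
      using convergent_imp_bounded[OF lim] by (auto simp: bounded_iff)
    obtain R where R: "\<And>y. y \<in> K \<Longrightarrow> norm y \<le> R"
      using compact_imp_bounded[OF cK(1)] by (auto simp: bounded_iff)
    have "norm (t k) \<le> B + R" for k
    proof -
      obtain y where y: "y \<in> K" "dist (t k) y \<le> hausdorff_dist (Z k) K"
        using hausdorff_dist_point[OF Z(1) cK tZ] by blast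
      have "norm (t k) \<le> norm y + norm (t k - y)" by (rule norm_triangle_sub)
      then show ?thesis using y B[of k] R[of y] by (simp add: dist_norm)
    qed
    then show ?thesis by (auto simp: bounded_iff)
  qed
  from 1 2 3 4 show thesis by (rule that)
qed

section \<open>Translates of sign zonotopes\<close>

lemma plus_image_eq: "(+) t ` S = {t} + S"
  by (auto simp: set_plus_def)

lemma sign_zonotope_eq: "sign_zonotope u a = (\<Sum>\<epsilon>\<in>sign_vectors. closed_segment 0 (a \<epsilon> *\<^sub>R signed u \<epsilon>))"
  by (simp add: sign_zonotope_def signed_def)

lemma compact_sign_zonotope: "compact (sign_zonotope u a)"
  unfolding sign_zonotope_eq by (rule compact_set_sum) simp

lemma convex_sign_zonotope: "convex (sign_zonotope u a)"
  unfolding sign_zonotope_eq by (rule convex_set_sum) simp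

lemma sign_zonotope_nonempty: "sign_zonotope u a \<noteq> {}"
  unfolding sign_zonotope_eq by (rule set_sum_nonempty) simp

lemma max_0_inner_scaleR:
  "0 \<le> r \<Longrightarrow> max 0 ((r *\<^sub>R w) \<bullet> x) = r * max 0 (w \<bullet> (x :: 'a::real_inner))"
  by (simp add: max_mult_distrib_left)

lemma support_fun_translate_sign_zonotope:
  assumes "\<forall>\<epsilon>\<in>sign_vectors. 0 \<le> a \<epsilon>"
  shows "support_fun ((+) t ` sign_zonotope u a) x
    = t \<bullet> x + (\<Sum>\<epsilon>\<in>sign_vectors. a \<epsilon> * max 0 (signed u \<epsilon> \<bullet> x))"
proof -
  have "support_fun {t} x = t \<bullet> x" by (simp add: support_fun_def inner_commute)
  moreover have "support_fun (sign_zonotope u a) x = (\<Sum>\<epsilon>\<in>sign_vectors. a \<epsilon> * max 0 (signed u \<epsilon> \<bullet> x))"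
    unfolding sign_zonotope_eq
    by (subst support_fun_sum)
      (use assms in \<open>auto simp: finite_sign_vectors support_fun_closed_segment max_0_inner_scaleR
        simp del: inner_scaleR_left intro!: sum.cong\<close>)
  ultimately show ?thesis
    unfolding plus_image_eq
    by (simp add: support_fun_plus compact_sign_zonotope sign_zonotope_nonempty)
qed

text \<open>By \<open>near\<close>, every edge may be replaced by its signed model without changing
  the limit of the support functions. What is left to converge is the translation and one bounded
  weight per sign pattern.\<close>

lemma eq_translate_sign_zonotope:
  fixes K :: "(real ^ 'n) set" and v :: "nat \<Rightarrow> nat \<Rightarrow> real ^ 'n"
  assumes K: "compact K" "convex K" "K \<noteq> {}"
    and supp: "\<And>x. (\<lambda>k. t k \<bullet> x + (\<Sum>j<m k. max 0 (v k j \<bullet> x))) \<longlonglongrightarrow> support_fun K x"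
    and limA: "(\<lambda>k. \<Sum>j<m k. norm (v k j)) \<longlonglongrightarrow> A"
    and t: "bounded (range t)"
    and near: "(\<lambda>k. \<Sum>j<m k. norm (v k j - norm (v k j) *\<^sub>R signed u (sign_vec (v k j)))) \<longlonglongrightarrow> 0"
  obtains s a where "\<forall>\<epsilon>\<in>sign_vectors. 0 \<le> a \<epsilon>" "K = (+) s ` sign_zonotope u a"
proof -
  \<comment> \<open>Edges with one sign pattern have parallel models, so their lengths merge into a
    single weight.\<close>
  define b where "b k \<epsilon> = (\<Sum>j\<in>{j\<in>{..<m k}. sign_vec (v k j) = \<epsilon>}. norm (v k j))" for k \<epsilon>
  let ?Y = "\<lambda>k. \<Sum>j<m k. norm (v k j - norm (v k j) *\<^sub>R signed u (sign_vec (v k j)))"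
  let ?H = "\<lambda>k x. t k \<bullet> x + (\<Sum>\<epsilon>\<in>sign_vectors. b k \<epsilon> * max 0 (signed u \<epsilon> \<bullet> x))"
  have group: "(\<Sum>\<epsilon>\<in>sign_vectors. b k \<epsilon> * max 0 (signed u \<epsilon> \<bullet> x))
      = (\<Sum>j<m k. max 0 ((norm (v k j) *\<^sub>R signed u (sign_vec (v k j))) \<bullet> x))" for k x
  proof -
    have "(\<Sum>\<epsilon>\<in>sign_vectors. b k \<epsilon> * max 0 (signed u \<epsilon> \<bullet> x))
        = (\<Sum>\<epsilon>\<in>sign_vectors. \<Sum>j\<in>{j\<in>{..<m k}. sign_vec (v k j) = \<epsilon>}.
            norm (v k j) * max 0 (signed u (sign_vec (v k j)) \<bullet> x))"
      unfolding b_def sum_distrib_right by (intro sum.cong) auto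
    also have "\<dots> = (\<Sum>j<m k. norm (v k j) * max 0 (signed u (sign_vec (v k j)) \<bullet> x))"
      by (rule sum.group) (auto simp: finite_sign_vectors sign_vec_in)
    finally show ?thesis by (simp add: max_0_inner_scaleR del: inner_scaleR_left)
  qed
  \<comment> \<open>The positive part is 1-Lipschitz, so replacing the edges costs at most
    \<open>?Y k * norm x\<close>.\<close>
  have H: "(\<lambda>k. ?H k x) \<longlonglongrightarrow> support_fun K x" for x
  proof -
    let ?S = "\<lambda>k. t k \<bullet> x + (\<Sum>j<m k. max 0 (v k j \<bullet> x))"
    have "norm (?H k x - ?S k) \<le> ?Y k * norm x" for k
    proof -
      have lip: "\<bar>max 0 (w \<bullet> x) - max 0 (z \<bullet> x)\<bar> \<le> norm (z - w) * norm x" for w z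
      proof -
        have "\<bar>max 0 (w \<bullet> x) - max 0 (z \<bullet> x)\<bar> \<le> \<bar>(z - w) \<bullet> x\<bar>"
          unfolding inner_diff_left by (auto simp: max_def abs_if)
        also have "\<dots> \<le> norm (z - w) * norm x" by (rule Cauchy_Schwarz_ineq2)
        finally show ?thesis .
      qed
      have "norm (?H k x - ?S k)
          = \<bar>\<Sum>j<m k. max 0 ((norm (v k j) *\<^sub>R signed u (sign_vec (v k j))) \<bullet> x) - max 0 (v k j \<bullet> x)\<bar>"
        unfolding group by (simp only: sum_subtractf real_norm_def add_diff_cancel_left)
      also have "\<dots> \<le> (\<Sum>j<m k. norm (v k j - norm (v k j) *\<^sub>R signed u (sign_vec (v k j))) * norm x)"
        by (rule order_trans[OF sum_abs sum_mono]) (rule lip)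
      finally show ?thesis by (simp only: sum_distrib_right)
    qed
    then have "\<forall>\<^sub>F k in sequentially. norm (?H k x - ?S k) \<le> ?Y k * norm x"
      by (rule always_eventually[OF allI])
    moreover have "(\<lambda>k. ?Y k * norm x) \<longlonglongrightarrow> 0"
      using tendsto_mult_right[OF near, of "norm x"] by simp
    ultimately have "(\<lambda>k. ?H k x - ?S k) \<longlonglongrightarrow> 0"
      by (rule Lim_null_comparison)
    from tendsto_add[OF this supp[of x]] show ?thesis by (simp only: diff_add_cancel add_0_left)
  qed
  obtain r s where r: "strict_mono r" "(t \<circ> r) \<longlonglongrightarrow> s"
    using bounded_imp_convergent_subsequence[OF t] by blast
  obtain B where B: "\<And>k. norm (\<Sum>j<m k. norm (v k j)) \<le> B"
    using convergent_imp_bounded[OF limA] by (auto simp: bounded_iff)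
  have b0: "0 \<le> b k \<epsilon>" for k \<epsilon> unfolding b_def by (simp add: sum_nonneg)
  have bB: "b k \<epsilon> \<le> B" for k \<epsilon>
  proof -
    have "b k \<epsilon> \<le> (\<Sum>j<m k. norm (v k j))"
      unfolding b_def by (rule sum_mono2) auto
    then show ?thesis using B[of k] by simp
  qed
  have bdd: "bounded (range (\<lambda>k. b (r k) \<epsilon>))" if "\<epsilon> \<in> sign_vectors" for \<epsilon>
    unfolding bounded_iff using b0 bB by (intro exI[of _ B]) auto
  obtain r' a where r': "strict_mono r'"
    and a: "\<And>\<epsilon>. \<epsilon> \<in> sign_vectors \<Longrightarrow> (\<lambda>k. b (r (r' k)) \<epsilon>) \<longlonglongrightarrow> a \<epsilon>"
    by (rule finite_bounded_subsequence[of sign_vectors "\<lambda>k. b (r k)", OF finite_sign_vectors bdd])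
      (assumption, rule that)
  have a0: "\<forall>\<epsilon>\<in>sign_vectors. 0 \<le> a \<epsilon>"
    by (intro ballI LIMSEQ_le_const[OF a] exI[of _ 0] allI impI b0)
  have "support_fun ((+) s ` sign_zonotope u a) x = support_fun K x" for x
  proof -
    have "(\<lambda>k. t (r (r' k))) \<longlonglongrightarrow> s"
      using LIMSEQ_subseq_LIMSEQ[OF r(2) r'] by (simp add: o_def)
    then have "(\<lambda>k. ?H (r (r' k)) x) \<longlonglongrightarrow> s \<bullet> x + (\<Sum>\<epsilon>\<in>sign_vectors. a \<epsilon> * max 0 (signed u \<epsilon> \<bullet> x))"
      by (intro tendsto_intros a)
    moreover have "(\<lambda>k. ?H (r (r' k)) x) \<longlonglongrightarrow> support_fun K x"
      using LIMSEQ_subseq_LIMSEQ[OF H strict_mono_o[OF r(1) r'], of x] by (simp add: o_def)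
    ultimately show ?thesis
      unfolding support_fun_translate_sign_zonotope[OF a0] by (rule LIMSEQ_unique)
  qed
  then have "(+) s ` sign_zonotope u a = K"
    using K by (intro compact_convex_eq_support_fun)
      (auto simp: compact_translation convex_translation compact_sign_zonotope convex_sign_zonotope sign_zonotope_nonempty)
  then show thesis using that[OF a0, of s] by simp
qed

section \<open>Positivity and the two equality cases\<close>

lemma first_intrinsic_volume_pos:
  fixes K :: "(real ^ 'n) set"
  assumes "compact K" "1 \<le> aff_dim K"
  shows "0 < first_intrinsic_volume K"
proof -
  have "K \<noteq> {}" using assms(2) by auto
  then obtain x where x: "x \<in> K" by blast
  have "K \<noteq> {x}" using assms(2) by auto
  then obtain y where y: "y \<in> K" "y \<noteq> x" using x by blast
  obtain c where c: "0 < c" "\<And>a b :: real ^ 'n. first_intrinsic_volume (closed_segment a b) = c * norm (b - a)"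
    by (rule first_intrinsic_volume_segment_const[where 'n = 'n]) (rule that)
  \<comment> \<open>\<open>K\<close> contains both endpoints, so its support function dominates that
    of a nondegenerate segment.\<close>
  have "support_fun (closed_segment x y) u \<le> support_fun K u" for u
    using support_fun_upper[OF assms(1) x, of u] support_fun_upper[OF assms(1) y(1), of u]
    by (simp add: support_fun_closed_segment inner_commute[of _ u] inner_diff_right max_def)
  then have "first_intrinsic_volume (closed_segment x y) \<le> first_intrinsic_volume K"
    using assms(1) \<open>K \<noteq> {}\<close> by (intro first_intrinsic_volume_mono) auto
  moreover have "0 < c * norm (y - x)" using c(1) y(2) by simp
  ultimately show ?thesis using c(2) by simp
qed

text \<open>With a single edge vector nothing is lost in the triangle inequality.\<close>

lemma first_intrinsic_volume_eq_segment:
  fixes x y :: "real ^ 'n"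
  shows "(\<Sum>i\<in>UNIV. (first_intrinsic_volume (coord_proj i (closed_segment x y)))\<^sup>2)
    = (real CARD('n) - 1) * (first_intrinsic_volume (closed_segment x y))\<^sup>2"
proof -
  obtain c where c: "\<And>a b :: real ^ 'n. first_intrinsic_volume (closed_segment a b) = c * norm (b - a)"
    by (rule first_intrinsic_volume_segment_const[where 'n = 'n]) (rule that)
  have "(\<Sum>i\<in>UNIV. (first_intrinsic_volume (coord_proj i (closed_segment x y)))\<^sup>2)
      = c\<^sup>2 * (norm (shadow_norms (y - x)))\<^sup>2"
    by (simp add: coord_proj_closed_segment c power2_norm_vec shadow_norms_nth power_mult_distrib
        sum_distrib_left linear_diff[OF linear_drop_coord])
  then show ?thesis by (simp add: power2_norm_shadow_norms c power_mult_distrib)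
qed

lemma first_intrinsic_volume_eq_sign_zonotope:
  fixes u t :: "real ^ 'n"
  assumes a: "\<forall>\<epsilon>\<in>sign_vectors. 0 \<le> a \<epsilon>"
  defines "K \<equiv> (+) t ` sign_zonotope u a"
  shows "(\<Sum>i\<in>UNIV. (first_intrinsic_volume (coord_proj i K))\<^sup>2)
    = (real CARD('n) - 1) * (first_intrinsic_volume K)\<^sup>2"
proof -
  obtain c where c: "\<And>a b :: real ^ 'n. first_intrinsic_volume (closed_segment a b) = c * norm (b - a)"
    by (rule first_intrinsic_volume_segment_const[where 'n = 'n]) (rule that)
  \<comment> \<open>The index \<open>None\<close> encodes the translation as a degenerate segment
    from \<open>t\<close> to \<open>t\<close>, so that the formulas for sums of segments
    apply.\<close>
  define J where "J = insert None (Some ` (sign_vectors :: (real ^ 'n) set))"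
  define p where "p j = (case j of None \<Rightarrow> t | Some \<epsilon> \<Rightarrow> 0)" for j :: "(real ^ 'n) option"
  define q where "q j = (case j of None \<Rightarrow> t | Some \<epsilon> \<Rightarrow> a \<epsilon> *\<^sub>R signed u \<epsilon>)" for j
  have J: "finite J" by (simp add: J_def finite_sign_vectors)
  have sumJ: "(\<Sum>j\<in>J. f j) = f None + (\<Sum>\<epsilon>\<in>sign_vectors. f (Some \<epsilon>))"
    for f :: "(real ^ 'n) option \<Rightarrow> 'b::comm_monoid_add"
    unfolding J_def using finite_sign_vectors by (subst sum.insert) (auto simp: sum.reindex)
  have K: "K = (\<Sum>j\<in>J. closed_segment (p j) (q j))"
    by (simp add: sumJ p_def q_def K_def plus_image_eq sign_zonotope_eq)
  define m where "m = (\<Sum>\<epsilon>\<in>sign_vectors. a \<epsilon>)"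
  have "(\<Sum>j\<in>J. norm (q j - p j)) = m * norm u"
    using a by (simp add: sumJ p_def q_def m_def norm_signed sum_distrib_right)
  then have VK: "first_intrinsic_volume K = c * (m * norm u)"
    unfolding K first_intrinsic_volume_segments(1)[OF c J] by simp
  have "shadow_norms (0 :: real ^ 'n) = 0"
    by (simp add: vec_eq_iff shadow_norms_nth drop_coord_def)
  then have "(\<Sum>j\<in>J. shadow_norms (q j - p j)) = m *\<^sub>R shadow_norms u"
    using a by (simp add: sumJ p_def q_def m_def shadow_norms_signed scaleR_sum_left)
  then have VP: "first_intrinsic_volume (coord_proj i K) = c * m * shadow_norms u $ i" for i
    unfolding K first_intrinsic_volume_segments(2)[OF c J] by simp
  have "(\<Sum>i\<in>UNIV. (first_intrinsic_volume (coord_proj i K))\<^sup>2) = (c * m)\<^sup>2 * (norm (shadow_norms u))\<^sup>2"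
    by (simp add: VP power2_norm_vec power_mult_distrib sum_distrib_left)
  then show ?thesis
    by (simp add: VK power2_norm_shadow_norms power_mult_distrib)
qed

theorem corollary5p2:
  fixes K :: "(real ^ 'n) set"
  assumes "CARD('n) \<ge> 3"
    and "zonoid K"
    and "aff_dim K \<ge> 1"
  shows "(first_intrinsic_volume K)\<^sup>2
           \<ge> 1 / (real CARD('n) - 1) * (\<Sum>i\<in>UNIV. (first_intrinsic_volume (coord_proj i K))\<^sup>2) \<and>
         ((first_intrinsic_volume K)\<^sup>2
            = 1 / (real CARD('n) - 1) * (\<Sum>i\<in>UNIV. (first_intrinsic_volume (coord_proj i K))\<^sup>2)
          \<longleftrightarrow> aff_dim K = 1 \<or>
              aff_dim K > 1 \<and>
              (\<exists>t u a. norm u = 1 \<and> (\<forall>\<epsilon>\<in>sign_vectors. a \<epsilon> \<ge> 0) \<and>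
                       K = (+) t ` sign_zonotope u a))"
proof -
  let ?n = "real CARD('n)" and ?V = "first_intrinsic_volume K"
  let ?P = "\<lambda>i. first_intrinsic_volume (coord_proj i K)"
  have n: "0 < ?n - 1" using assms(1) by linarith
  have K: "compact K" "K \<noteq> {}" "convex K"
    using assms(2) zonoid_convex by (auto simp: zonoid_def)
  obtain c where c0: "0 < c"
    and c: "\<And>a b :: real ^ 'n. first_intrinsic_volume (closed_segment a b) = c * norm (b - a)"
    by (rule first_intrinsic_volume_segment_const[where 'n = 'n]) (rule that)
  define A where "A = ?V / c"
  define F where "F = (\<chi> i. ?P i / c)"
  obtain m :: "nat \<Rightarrow> nat" and t v where
    supp: "\<And>x. (\<lambda>k. t k \<bullet> x + (\<Sum>j<m k. max 0 (v k j \<bullet> x))) \<longlonglongrightarrow> support_fun K x"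
    and limA: "(\<lambda>k. \<Sum>j<m k. norm (v k j)) \<longlonglongrightarrow> A"
    and limF: "(\<lambda>k. \<Sum>j<m k. shadow_norms (v k j)) \<longlonglongrightarrow> F"
    and t: "bounded (range t)"
    by (rule zonoid_approximation[OF assms(2) c0 c, folded A_def F_def]) (rule that)
  have A: "0 < A" using first_intrinsic_volume_pos[OF K(1) assms(3)] c0 by (simp add: A_def)
  have normF: "c\<^sup>2 * (norm F)\<^sup>2 = (\<Sum>i\<in>UNIV. (?P i)\<^sup>2)"
    using c0 by (simp add: power2_norm_vec F_def sum_distrib_left power_divide)
  have V: "?V\<^sup>2 = c\<^sup>2 * A\<^sup>2"
    using c0 by (simp add: A_def power_divide)
  \<comment> \<open>The triangle inequality for the approximating zonotopes, passed to the
    limit.\<close>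
  have "(norm F)\<^sup>2 \<le> (?n - 1) * A\<^sup>2"
    by (rule tendsto_le[OF _ tendsto_mult[OF tendsto_const tendsto_power[OF limA]]
          tendsto_power[OF tendsto_norm[OF limF]]]) (auto intro: always_eventually norm_sum_shadow_norms)
  then have "c\<^sup>2 * (norm F)\<^sup>2 \<le> c\<^sup>2 * ((?n - 1) * A\<^sup>2)" by (rule mult_left_mono) simp
  then have "(\<Sum>i\<in>UNIV. (?P i)\<^sup>2) \<le> (?n - 1) * ?V\<^sup>2"
    unfolding normF V by (simp add: ac_simps)
  then have ineq: "1 / (?n - 1) * (\<Sum>i\<in>UNIV. (?P i)\<^sup>2) \<le> ?V\<^sup>2"
    using n by (simp add: field_simps)
  have eq_iff: "?V\<^sup>2 = 1 / (?n - 1) * (\<Sum>i\<in>UNIV. (?P i)\<^sup>2)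
      \<longleftrightarrow> (\<Sum>i\<in>UNIV. (?P i)\<^sup>2) = (?n - 1) * ?V\<^sup>2"
    using n by (auto simp: field_simps)
  have "\<exists>t u a. norm u = 1 \<and> (\<forall>\<epsilon>\<in>sign_vectors. a \<epsilon> \<ge> 0) \<and> K = (+) t ` sign_zonotope u a"
    if eq: "(\<Sum>i\<in>UNIV. (?P i)\<^sup>2) = (?n - 1) * ?V\<^sup>2"
  proof -
    have "c\<^sup>2 * (norm F)\<^sup>2 = c\<^sup>2 * ((?n - 1) * A\<^sup>2)" using eq unfolding normF V by (simp add: ac_simps)
    then have eqF: "(norm F)\<^sup>2 = (?n - 1) * A\<^sup>2" using c0 by simp
    have limFi: "(\<lambda>k. \<Sum>j<m k. norm (drop_coord i (v k j))) \<longlonglongrightarrow> F $ i" for i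
      using tendsto_vec_nth[OF limF, of i] by (simp add: shadow_norms_nth)
    have F0: "0 \<le> F $ i" for i
      by (rule LIMSEQ_le_const[OF limFi]) (simp add: sum_nonneg)
    have FA: "F $ i \<le> A" for i
      by (rule LIMSEQ_le[OF limFi limA]) (intro exI allI impI sum_mono norm_drop_coord_le)
    \<comment> \<open>If all edges were multiples of signed copies of a unit vector
      \<open>u\<close>, then \<open>F $ i / A\<close> would be the length of its shadow, with square
      \<open>1 - (u $ i)\<^sup>2\<close>; this is solved for a nonnegative
      \<open>u $ i\<close>.\<close>
    define u where "u = (\<chi> i. sqrt (1 - (F $ i / A)\<^sup>2))"
    have u: "u $ i = sqrt (1 - (F $ i / A)\<^sup>2)" for i by (simp add: u_def)
    have "(F $ i / A)\<^sup>2 \<le> 1" for i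
      using A F0 FA by (intro power_le_one) auto
    then have "(norm u)\<^sup>2 = (\<Sum>i\<in>UNIV. 1 - (F $ i / A)\<^sup>2)"
      unfolding power2_norm_vec u by (intro sum.cong) auto
    also have "\<dots> = ?n - (norm F)\<^sup>2 / A\<^sup>2"
      by (simp add: sum_subtractf power2_norm_vec power_divide sum_divide_distrib)
    \<comment> \<open>Here equality enters: it makes the quotient \<open>?n - 1\<close>.\<close>
    also have "\<dots> = 1" using A by (simp add: eqF)
    finally have "norm u = 1" by (metis norm_ge_zero one_power2 power2_eq_imp_eq zero_le_one)
    moreover obtain s a where "\<forall>\<epsilon>\<in>sign_vectors. 0 \<le> a \<epsilon>" "K = (+) s ` sign_zonotope u a"
      by (rule eq_translate_sign_zonotope[OF K(1,3,2) supp limA t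
          sum_dist_signed_tendsto_0[OF A F0 FA eqF u limA limF]])
    ultimately show ?thesis by (intro exI conjI)
  qed
  moreover have "(\<Sum>i\<in>UNIV. (?P i)\<^sup>2) = (?n - 1) * ?V\<^sup>2" if "aff_dim K = 1"
  proof -
    have "collinear K" using that by (simp add: collinear_aff_dim)
    then obtain x y where "K = closed_segment x y"
      using compact_convex_collinear_segment K by metis
    then show ?thesis using first_intrinsic_volume_eq_segment by blast
  qed
  moreover have "(\<Sum>i\<in>UNIV. (?P i)\<^sup>2) = (?n - 1) * ?V\<^sup>2"
    if "\<forall>\<epsilon>\<in>sign_vectors. a \<epsilon> \<ge> 0" "K = (+) t ` sign_zonotope u a" for t u a
    using first_intrinsic_volume_eq_sign_zonotope[OF that(1), of t u] that(2) by simp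
  ultimately show ?thesis
    using ineq assms(3) unfolding eq_iff by (metis less_le)
qed

end
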